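(* Let $r>2$ be an integer, and let $A \subseteq \{x \ge 1: x \equiv 1 \bmod r\}$ and $B \subseteq \{x \ge 1: x \equiv 0 \bmod r\}$ be such that $1\in A$ and $A\cup B$ is odd-ended (in the $r$-stretched sense). Define $(c_n)_{n\ge 0}$ by $$\left(1-\sum_{a \in A} \frac{x^a}{a!} + \sum_{b \in B} \frac{x^b}{b!}\right)^{-1} = \sum_{n \ge 0} c_n \frac{x^n}{n!}.$$ Then every $c_n$ is a non-negative integer, and $$c_n=\sum_{\sigma} w_\sigma,$$ where the sum is over all permutations $\sigma$ of $[n]=\{1,\ldots,n\}$ and $w_\sigma$ is the weight of $\sigma$.
   Context: Put $\mathbb{N}^*=\{1,r,r+1,2r,2r+1,\ldots\}$ (positive integers congruent to $0$ or $1$ mod $r$), listed increasingly; "intervals" are sets of consecutive elements of $\mathbb{N}^*$. Write $A\cup B$ as the disjoint union of its maximal intervals in $\mathbb{N}^*$ (possibly one infinite). $A\cup B$ is odd-ended if all (finite) endpoints of the maximal intervals are $\equiv 1 \bmod r$; equivalently, $kr\in B$ implies $kr+1\in A$ and $(k-1)r+1\in A$. An element of $A\cup B$ is a top element if the next larger element of $\mathbb{N}^*$ is not in $A\cup B$, and a bottom element if it equals $1$ or the next smaller element of $\mathbb{N}^*$ is not in $A\cup B$. For an ordered set partition $P=P_1/\cdots/P_t$ (a sequence of disjoint nonempty blocks), its underlying permutation is obtained by writing each block in increasing order and concatenating the blocks. A singleton is a block of size 1. Consecutive blocks $P_i,\ldots,P_j$ are collectively increasing if $\max P_h<\min P_{h+1}$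 for $i\le h<j$. Freeze skip $r$-tuples of $P$ are determined by scanning from right to left starting with $j=t$. When $P_j$ is considered: if $j\ge r$, the $r-1$ blocks $P_{j-r+2},\ldots,P_j$ are singletons, $|P_{j-r+1}|\equiv 1 \bmod r$ and $P_{j-r+1},\ldots,P_j$ are collectively increasing, then: if $|P_{j-r+1}|$ is a top element, $(P_{j-r+1},\ldots,P_j)$ is a freeze skip $r$-tuple and the scan continues with $P_{j-r}$; if $|P_{j-r+1}|$ is not a top element, the scan stops. In all other cases the scan continues with $P_{j-1}$. For $\ell\ge 1$, the weight $w_\ell$ is the number of ordered set partitions of $\{1,\ldots,\ell\}$ with underlying permutation $12\cdots\ell$ such that: (1) every block size is either $1$ or an endpoint (top or bottom element) of a maximal interval of $A\cup B$; (2) every block whose size is a top element that is not a bottom element belongs to a freeze skip $r$-tuple; (3) no block whose size is a bottom element that is not a top element is immediately followed by $r-1$ singletons none of which is in a freeze skip $r$-tuple. The weight $w_\sigma$ of a permutation $\sigma$ of $[n]$ (in one-line notation) is the product of $w_\ell$ over the lengths $\ell$ of all maximal increasing runs (maximal increasing strings of consecutive entries) of $\sigma$; the weight of the empty permutation is $1$. *)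

theory Defs
  imports
    "HOL-Computational_Algebra.Formal_Power_Series"
    "HOL-Combinatorics.Multiset_Permutations"
    "HOL-Library.Disjoint_Sets"
    "HOL-Number_Theory.Cong"
begin

definition Nstar :: "nat \<Rightarrow> nat set" where
  "Nstar r = {x. x \<ge> 1 \<and> ([x = 0] (mod r) \<or> [x = 1] (mod r))}"

definition Nstar_interval :: "nat \<Rightarrow> nat set \<Rightarrow> bool" where
  "Nstar_interval r I \<longleftrightarrow> I \<noteq> {} \<and> I \<subseteq> Nstar r \<and>
     (\<forall>x\<in>I. \<forall>z\<in>I. \<forall>y\<in>Nstar r. x \<le> y \<and> y \<le> z \<longrightarrow> y \<in> I)"

definition maximal_interval :: "nat \<Rightarrow> nat set \<Rightarrow> nat set \<Rightarrow> bool" where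
  "maximal_interval r S I \<longleftrightarrow> Nstar_interval r I \<and> I \<subseteq> S \<and>
     (\<forall>J. Nstar_interval r J \<and> J \<subseteq> S \<and> I \<subseteq> J \<longrightarrow> J = I)"

text \<open>An infinite maximal interval has only its least element as an endpoint.\<close>

definition is_endpoint :: "nat \<Rightarrow> nat set \<Rightarrow> bool" where
  "is_endpoint x I \<longleftrightarrow> x \<in> I \<and> ((\<forall>y\<in>I. x \<le> y) \<or> (\<forall>y\<in>I. y \<le> x))"

definition odd_ended :: "nat \<Rightarrow> nat set \<Rightarrow> bool" where
  "odd_ended r S \<longleftrightarrow> (\<forall>I x. maximal_interval r S I \<and> is_endpoint x I \<longrightarrow> [x = 1] (mod r))"

definition is_top :: "nat \<Rightarrow> nat set \<Rightarrow> nat \<Rightarrow> bool" where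
  "is_top r S x \<longleftrightarrow> x \<in> S \<and> (LEAST y. y \<in> Nstar r \<and> x < y) \<notin> S"

definition is_bottom :: "nat \<Rightarrow> nat set \<Rightarrow> nat \<Rightarrow> bool" where
  "is_bottom r S x \<longleftrightarrow> x \<in> S \<and> (x = 1 \<or> (GREATEST y. y \<in> Nstar r \<and> y < x) \<notin> S)"

definition ordered_set_partition :: "nat set \<Rightarrow> nat set list \<Rightarrow> bool" where
  "ordered_set_partition X P \<longleftrightarrow> partition_on X (set P) \<and> distinct P"

definition underlying_permutation :: "nat set list \<Rightarrow> nat list" where
  "underlying_permutation P = concat (map sorted_list_of_set P)"

text \<open>Blocks are numbered from 1, as in \<open>P = P\<^sub>1/\<dots>/P\<^sub>t\<close>.\<close>

definition blk :: "nat set list \<Rightarrow> nat \<Rightarrow> nat set" where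
  "blk P h = P ! (h - 1)"

definition collectively_increasing :: "nat set list \<Rightarrow> nat \<Rightarrow> nat \<Rightarrow> bool" where
  "collectively_increasing P i j \<longleftrightarrow> (\<forall>h\<in>{i..<j}. Max (blk P h) < Min (blk P (h + 1)))"

definition skip_candidate :: "nat \<Rightarrow> nat set list \<Rightarrow> nat \<Rightarrow> bool" where
  "skip_candidate r P j \<longleftrightarrow> j \<ge> r \<and>
     (\<forall>h\<in>{j - r + 2..j}. card (blk P h) = 1) \<and>
     [card (blk P (j - r + 1)) = 1] (mod r) \<and>
     collectively_increasing P (j - r + 1) j"

text \<open>
  The scan from right to left, about to consider block \<open>j\<close>; it returns the set of all freeze
  skip tuples found from there on, a tuple being represented by the set of the numbers of its
  blocks. The case \<open>r = 0\<close> is irrelevant and only ensures termination.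
\<close>

fun freeze_scan :: "nat \<Rightarrow> nat set \<Rightarrow> nat set list \<Rightarrow> nat \<Rightarrow> nat set set" where
  "freeze_scan r S P j =
     (if r = 0 \<or> j = 0 then {}
      else if skip_candidate r P j then
        (if is_top r S (card (blk P (j - r + 1)))
         then insert {j - r + 1..j} (freeze_scan r S P (j - r))
         else {})
      else freeze_scan r S P (j - 1))"

declare freeze_scan.simps [simp del]

definition in_freeze_skip :: "nat \<Rightarrow> nat set \<Rightarrow> nat set list \<Rightarrow> nat \<Rightarrow> bool" where
  "in_freeze_skip r S P i \<longleftrightarrow> i \<in> \<Union> (freeze_scan r S P (length P))"

definition admissible_partition :: "nat \<Rightarrow> nat set \<Rightarrow> nat set list \<Rightarrow> bool" where
  "admissible_partition r S P \<longleftrightarrow>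
     (\<forall>i\<in>{1..length P}.
        card (blk P i) = 1 \<or> is_top r S (card (blk P i)) \<or> is_bottom r S (card (blk P i))) \<and>
     (\<forall>i\<in>{1..length P}.
        is_top r S (card (blk P i)) \<and> \<not> is_bottom r S (card (blk P i)) \<longrightarrow>
        in_freeze_skip r S P i) \<and>
     \<not> (\<exists>i\<in>{1..length P}.
        is_bottom r S (card (blk P i)) \<and> \<not> is_top r S (card (blk P i)) \<and>
        i + (r - 1) \<le> length P \<and>
        (\<forall>h\<in>{i + 1..i + (r - 1)}. card (blk P h) = 1 \<and> \<not> in_freeze_skip r S P h))"

definition run_weight :: "nat \<Rightarrow> nat set \<Rightarrow> nat \<Rightarrow> nat" where
  "run_weight r S l = card {P. ordered_set_partition {1..l} P \<and>
     underlying_permutation P = [1..<l + 1] \<and> admissible_partition r S P}"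

text \<open>
  A string of consecutive entries of a list is given by the half-open range \<open>{i..<j}\<close> of its
  (0-based) positions.
\<close>

definition increasing_string :: "nat list \<Rightarrow> nat \<Rightarrow> nat \<Rightarrow> bool" where
  "increasing_string xs i j \<longleftrightarrow> i < j \<and> j \<le> length xs \<and>
     sorted_wrt (<) (take (j - i) (drop i xs))"

definition increasing_runs :: "nat list \<Rightarrow> (nat \<times> nat) set" where
  "increasing_runs xs = {(i, j). increasing_string xs i j \<and>
     (\<forall>i' j'. increasing_string xs i' j' \<and> i' \<le> i \<and> j \<le> j' \<longrightarrow> i' = i \<and> j' = j)}"

definition perm_weight :: "nat \<Rightarrow> nat set \<Rightarrow> nat list \<Rightarrow> nat" where
  "perm_weight r S xs = (\<Prod>(i, j)\<in>increasing_runs xs. run_weight r S (j - i))"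

text \<open>The formal power series \<open>\<Sum>a\<in>A. x^a / a!\<close> for a possibly infinite set \<open>A\<close>.\<close>

definition egf_of_set :: "nat set \<Rightarrow> real fps" where
  "egf_of_set A = Abs_fps (\<lambda>n. if n \<in> A then 1 / fact n else 0)"

end

theory Submission
  imports Defs
begin

text \<open>
  Let \<open>f\<close> be the signed indicator of \<open>A\<close> (sign \<open>+\<close>) and \<open>B\<close> (sign \<open>-\<close>). By the run theorem
  (exponential versus ordinary reciprocals) it suffices that the ordinary generating functions satisfy
  \<open>(\<Sum>w\<^sub>l x^l) (1 - \<Sum>f\<^sub>k x^k) = 1\<close>.

  A set partition with identity underlying permutation is a composition. Read from the right, an
  admissible composition is uniquely either fewer than \<open>r\<close> ones, or an admissible composition followed by
  \<open>c, 1, \<dots>, 1\<close>, where \<open>c > 1\<close> is a bottom and there are fewer than \<open>r - 1\<close> ones, or \<open>c\<close> is a top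
  (possibly \<open>c = 1\<close>) and there are exactly \<open>r - 1\<close> ones. This gives a linear equation for
  \<open>\<Sum>w\<^sub>l x^l\<close>. Multiplied by \<open>1 - x\<close> it agrees with the required one multiplied by \<open>1 - x^r\<close>, because
  \<open>(1 - x^r) \<Sum>f\<^sub>k x^k\<close> telescopes along the maximal intervals of \<open>A \<union> B\<close>.
\<close>

unbundle fps_syntax

subsection \<open>Weighted increasing runs\<close>

text \<open>\<open>perm_weight\<close> with an arbitrary weight function; real values allow a
  recursion with signed coefficients.\<close>

definition string_weight :: "(nat \<Rightarrow> 'a::comm_semiring_1) \<Rightarrow> nat list \<Rightarrow> 'a" where
  "string_weight w xs = (\<Prod>(i, j)\<in>increasing_runs xs. w (j - i))"

text \<open>Transitivity of \<open><\<close> reduces sortedness to neighbouring entries. Positions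
  refer to \<open>xs\<close> itself, so strings with different ends can be compared
  directly.\<close>

lemma increasing_string_iff:
  "increasing_string xs i j \<longleftrightarrow>
     i < j \<and> j \<le> length xs \<and> (\<forall>k. i \<le> k \<and> Suc k < j \<longrightarrow> xs ! k < xs ! Suc k)"
proof -
  have "sorted_wrt (<) (take (j - i) (drop i xs)) \<longleftrightarrow>
      (\<forall>k. i \<le> k \<and> Suc k < j \<longrightarrow> xs ! k < xs ! Suc k)" if "i < j" "j \<le> length xs"
  proof -
    have "sorted_wrt (<) (take (j - i) (drop i xs)) \<longleftrightarrow>
        (\<forall>k. Suc k < j - i \<longrightarrow> xs ! (i + k) < xs ! Suc (i + k))"
      using that by (subst sorted_wrt_iff_nth_Suc_transp) auto
    also have "\<dots> \<longleftrightarrow> (\<forall>k. i \<le> k \<and> Suc k < j \<longrightarrow> xs ! k < xs ! Suc k)"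
      (is "?L \<longleftrightarrow> ?R")
    proof
      assume L: ?L
      show ?R
      proof (intro allI impI)
        fix k assume "i \<le> k \<and> Suc k < j"
        then show "xs ! k < xs ! Suc k" using L[rule_format, of "k - i"] by auto
      qed
    qed auto
    finally show ?thesis .
  qed
  then show ?thesis unfolding increasing_string_def by blast
qed

text \<open>Maximality need only be tested one entry beyond each end: a longer increasing string
  contains the ascent there, and conversely an ascent there extends the string.\<close>

lemma increasing_runs_iff:
  "(i, j) \<in> increasing_runs xs \<longleftrightarrow> increasing_string xs i j \<and>
     (i = 0 \<or> \<not> xs ! (i - 1) < xs ! i) \<and> (j = length xs \<or> \<not> xs ! (j - 1) < xs ! j)"
  (is "?L \<longleftrightarrow> ?R")
proof
  assume ?L
  then have ij: "increasing_string xs i j"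
    and max: "\<And>i' j'. increasing_string xs i' j' \<Longrightarrow> i' \<le> i \<Longrightarrow> j \<le> j' \<Longrightarrow> i' = i \<and> j' = j"
    by (auto simp: increasing_runs_def)
  have "\<not> xs ! (i - 1) < xs ! i" if "i \<noteq> 0"
  proof
    assume a: "xs ! (i - 1) < xs ! i"
    have "increasing_string xs (i - 1) j"
      unfolding increasing_string_iff
    proof (intro conjI allI impI)
      show "i - 1 < j" "j \<le> length xs"
        using ij unfolding increasing_string_iff by auto
      fix k assume k: "i - 1 \<le> k \<and> Suc k < j"
      show "xs ! k < xs ! Suc k"
      proof (cases "k = i - 1")
        case True
        then show ?thesis using a that by simp
      next
        case False
        then have "i \<le> k" using k by linarith
        then show ?thesis using k ij unfolding increasing_string_iff by blast
      qed
    qed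
    then show False using max[of "i - 1" j] that by auto
  qed
  moreover have "\<not> xs ! (j - 1) < xs ! j" if "j \<noteq> length xs"
  proof
    assume a: "xs ! (j - 1) < xs ! j"
    have "increasing_string xs i (Suc j)"
      unfolding increasing_string_iff
    proof (intro conjI allI impI)
      show "i < Suc j" "Suc j \<le> length xs"
        using ij that unfolding increasing_string_iff by auto
      fix k assume "i \<le> k \<and> Suc k < Suc j"
      then show "xs ! k < xs ! Suc k"
        using ij a unfolding increasing_string_iff by (cases "Suc k = j") auto
    qed
    then show False using max[of i "Suc j"] by auto
  qed
  ultimately show ?R using ij by blast
next
  assume R: ?R
  have "i' = i \<and> j' = j" if s: "increasing_string xs i' j'" and le: "i' \<le> i" "j \<le> j'" for i' j'
  proof (intro conjI; rule ccontr)
    assume "i' \<noteq> i"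
    then have "i' \<le> i - 1 \<and> Suc (i - 1) < j'" "i \<noteq> 0"
      using le R unfolding increasing_string_iff by auto
    then have "xs ! (i - 1) < xs ! Suc (i - 1)"
      using s unfolding increasing_string_iff by blast
    then show False using R \<open>i \<noteq> 0\<close> by simp
  next
    assume "j' \<noteq> j"
    then have "i' \<le> j - 1 \<and> Suc (j - 1) < j'" "j \<noteq> length xs" "j \<noteq> 0"
      using le R s unfolding increasing_string_iff by auto
    moreover from this have "xs ! (j - 1) < xs ! Suc (j - 1)"
      using s unfolding increasing_string_iff by blast
    ultimately show False using R by simp
  qed
  then show ?L using R by (auto simp: increasing_runs_def)
qed

lemma finite_increasing_runs: "finite (increasing_runs xs)"
proof (rule finite_subset)
  show "increasing_runs xs \<subseteq> {..length xs} \<times> {..length xs}"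
    by (auto simp: increasing_runs_def increasing_string_def)
qed simp

text \<open>No ascent crosses position \<open>l\<close>, so no run does; apart from the first run,
  the runs are those of the suffix shifted by \<open>l\<close>.\<close>

lemma increasing_runs_split:
  assumes "0 < l" "l \<le> length xs" "\<And>k. Suc k < l \<Longrightarrow> xs ! k < xs ! Suc k"
    and "l = length xs \<or> \<not> xs ! (l - 1) < xs ! l"
  shows "increasing_runs xs =
    insert (0, l) ((\<lambda>(i, j). (l + i, l + j)) ` increasing_runs (drop l xs))"
proof -
  have first: "i = 0 \<and> j = l" if ij: "(i, j) \<in> increasing_runs xs"
    and notin: "(i, j) \<notin> (\<lambda>(i, j). (l + i, l + j)) ` increasing_runs (drop l xs)" for i j
  proof -
  have "i < l"
  proof (rule ccontr)
    \<comment> \<open>A run that starts at \<open>l\<close> or later is a shifted run of the suffix,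
      contrary to \<open>notin\<close>.\<close>
    assume "\<not> i < l"
    then obtain i' where i': "i = l + i'" by (metis add_diff_inverse_nat)
    moreover obtain j' where j': "j = l + j'"
      using ij \<open>\<not> i < l\<close> unfolding increasing_runs_iff increasing_string_iff
      by (metis add_diff_inverse_nat order_less_trans)
    have "(i', j') \<in> increasing_runs (drop l xs)"
      unfolding increasing_runs_iff increasing_string_iff
    proof (intro conjI allI impI)
      show "i' < j'" "j' \<le> length (drop l xs)"
        using ij i' j' assms(2) unfolding increasing_runs_iff increasing_string_iff by auto
      show "drop l xs ! k < drop l xs ! Suc k" if "i' \<le> k \<and> Suc k < j'" for k
        using ij i' j' assms(2) that unfolding increasing_runs_iff increasing_string_iff
        by (metis add_Suc_right add_less_cancel_left nat_add_left_cancel_le nth_drop)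
      show "i' = 0 \<or> \<not> drop l xs ! (i' - 1) < drop l xs ! i'"
        using ij i' assms(1,2) unfolding increasing_runs_iff by auto
      show "j' = length (drop l xs) \<or> \<not> drop l xs ! (j' - 1) < drop l xs ! j'"
        using ij i' j' assms(2) unfolding increasing_runs_iff increasing_string_iff by auto
    qed
    then show False using notin i' j' by (auto simp: image_iff)
  qed
  have "j \<le> l"
  proof (rule ccontr)
    assume "\<not> j \<le> l"
    then have "i \<le> l - 1 \<and> Suc (l - 1) < j" using \<open>i < l\<close> assms(1) by auto
    then have "xs ! (l - 1) < xs ! Suc (l - 1)"
      using ij unfolding increasing_runs_iff increasing_string_iff by blast
    then show False using assms ij \<open>\<not> j \<le> l\<close>
      unfolding increasing_runs_iff increasing_string_iff by auto
  qed
  have "i = 0"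
    using assms(3)[of "i - 1"] ij \<open>i < l\<close> unfolding increasing_runs_iff by (cases i) auto
  moreover have "j = l"
    using assms(2) assms(3)[of "j - 1"] ij \<open>j \<le> l\<close>
    unfolding increasing_runs_iff increasing_string_iff by (cases j) (auto simp: le_less)
  ultimately show ?thesis by simp
  qed
  moreover have "(0, l) \<in> increasing_runs xs"
    using assms by (auto simp: increasing_runs_iff increasing_string_iff)
  moreover have "(l + i, l + j) \<in> increasing_runs xs"
    if ij: "(i, j) \<in> increasing_runs (drop l xs)" for i j
    unfolding increasing_runs_iff increasing_string_iff
  proof (intro conjI allI impI)
    show "l + i < l + j" "l + j \<le> length xs"
      using ij assms(2) unfolding increasing_runs_iff increasing_string_iff by auto
    show "xs ! k < xs ! Suc k" if "l + i \<le> k \<and> Suc k < l + j" for k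
    proof -
      have "i \<le> k - l \<and> Suc (k - l) < j" using that by auto
      then have "drop l xs ! (k - l) < drop l xs ! Suc (k - l)"
        using ij unfolding increasing_runs_iff increasing_string_iff by blast
      then show ?thesis using that assms(2) by simp
    qed
    \<comment> \<open>For \<open>i = 0\<close> the comparison is the one across position
      \<open>l\<close>, where the last assumption excludes an ascent.\<close>
    show "l + i = 0 \<or> \<not> xs ! (l + i - 1) < xs ! (l + i)"
      using ij assms(1,2,4) unfolding increasing_runs_iff increasing_string_iff
      by (cases i) auto
    show "l + j = length xs \<or> \<not> xs ! (l + j - 1) < xs ! (l + j)"
      using ij assms(1,2) unfolding increasing_runs_iff increasing_string_iff
      by (cases j) auto
  qed
  ultimately show ?thesis by auto
qed

lemma string_weight_split:
  assumes "0 < l" "l \<le> length xs" "\<And>k. Suc k < l \<Longrightarrow> xs ! k < xs ! Suc k"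
    and "l = length xs \<or> \<not> xs ! (l - 1) < xs ! l"
  shows "string_weight w xs = w l * string_weight w (drop l xs)"
proof -
  let ?s = "\<lambda>(i, j). (l + i, l + j)"
  have "string_weight w xs = (\<Prod>(i, j)\<in>insert (0, l) (?s ` increasing_runs (drop l xs)). w (j - i))"
    unfolding string_weight_def by (subst increasing_runs_split[OF assms]) auto
  also have "\<dots> = w l * (\<Prod>(i, j)\<in>?s ` increasing_runs (drop l xs). w (j - i))"
    using assms(1) by (subst prod.insert) (auto simp: finite_increasing_runs)
  also have "(\<Prod>(i, j)\<in>?s ` increasing_runs (drop l xs). w (j - i)) = string_weight w (drop l xs)"
    unfolding string_weight_def by (subst prod.reindex) (auto simp: inj_on_def case_prod_unfold)
  finally show ?thesis .
qed

section \<open>Summing the weight over all permutations\<close>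

lemma string_weight_Nil: "string_weight w [] = 1"
proof -
  have "increasing_runs [] = {}" by (auto simp: increasing_runs_def increasing_string_def)
  then show ?thesis by (simp add: string_weight_def)
qed

text \<open>The increasing prefixes are the prefixes of the first run. Removing \<open>k\<close>
  entries from a first run of length \<open>l\<close> leaves one of length \<open>l - k\<close> and
  the other runs unchanged, so the recursion for \<open>w l\<close> carries over to the whole
  weight.\<close>

lemma string_weight_convolution:
  fixes f w :: "nat \<Rightarrow> 'a::comm_semiring_1"
  assumes w0: "w 0 = 1" and w: "\<And>n. n > 0 \<Longrightarrow> w n = (\<Sum>k\<in>{1..n}. f k * w (n - k))"
    and "xs \<noteq> []"
  shows "string_weight w xs =
    (\<Sum>k | 0 < k \<and> k \<le> length xs \<and> sorted_wrt (<) (take k xs). f k * string_weight w (drop k xs))"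
proof -
  define Q where "Q k \<longleftrightarrow> k \<le> length xs \<and> sorted_wrt (<) (take k xs)" for k
  have Q_iff: "Q k \<longleftrightarrow> k \<le> length xs \<and> (\<forall>i. Suc i < k \<longrightarrow> xs ! i < xs ! Suc i)" for k
    unfolding Q_def by (auto simp: sorted_wrt_iff_nth_Suc_transp)
  \<comment> \<open>The length of the first run, taken as the longest increasing prefix.\<close>
  define l where "l = (GREATEST k. Q k)"
  have bound: "k \<le> length xs" if "Q k" for k using that by (simp add: Q_def)
  have "Q 1" using assms(3) by (auto simp: Q_iff Suc_le_eq)
  then have "Q l" unfolding l_def by (rule GreatestI_nat) (use bound in blast)
  have le_l: "k \<le> l" if "Q k" for k
    unfolding l_def using that by (rule Greatest_le_nat) (use bound in blast)
  have "l > 0" using le_l[OF \<open>Q 1\<close>] by simp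
  have stop: "\<not> xs ! (l - 1) < xs ! l" if "l \<noteq> length xs"
  proof
    assume "xs ! (l - 1) < xs ! l"
    then have "Q (Suc l)" using \<open>Q l\<close> \<open>l > 0\<close> that unfolding Q_iff
      by (auto simp: less_Suc_eq)
    then show False using le_l by fastforce
  qed
  \<comment> \<open>For \<open>k = l\<close> the first run has disappeared entirely; the convention
    \<open>w 0 = 1\<close> covers this case.\<close>
  have split: "string_weight w (drop k xs) = w (l - k) * string_weight w (drop l xs)" if "k \<le> l" for k
  proof (cases "k = l")
    case False
    with that have "k < l" by simp
    have "string_weight w (drop k xs) = w (l - k) * string_weight w (drop (l - k) (drop k xs))"
      by (rule string_weight_split)
        (use \<open>Q l\<close> \<open>k < l\<close> stop in \<open>auto simp: Q_iff\<close>)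
    then show ?thesis using \<open>k < l\<close> by simp
  qed (simp add: w0)
  have Qs: "{k. 0 < k \<and> Q k} = {1..l}"
    using le_l \<open>Q l\<close> by (fastforce simp: Q_iff)
  have "string_weight w xs = (\<Sum>k\<in>{1..l}. f k * w (l - k)) * string_weight w (drop l xs)"
    using split[of 0] w[OF \<open>l > 0\<close>] by simp
  also have "\<dots> = (\<Sum>k\<in>{1..l}. f k * string_weight w (drop k xs))"
    unfolding sum_distrib_right mult.assoc
    by (intro sum.cong refl arg_cong[where f = "(*) _"] split[symmetric]) auto
  finally show ?thesis using Qs by (simp add: Q_def)
qed

text \<open>A permutation with a chosen increasing prefix is the same as the set \<open>K\<close> of
  prefix entries with an arbitrary arrangement of the rest: whether an ascent or a descent follows
  the prefix is not prescribed, so no condition links the two.\<close>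

lemma sum_string_weight_rec:
  fixes f w :: "nat \<Rightarrow> 'a::comm_semiring_1"
  assumes w0: "w 0 = 1" and w: "\<And>n. n > 0 \<Longrightarrow> w n = (\<Sum>k\<in>{1..n}. f k * w (n - k))"
    and fin: "finite X" and "X \<noteq> {}"
  shows "(\<Sum>\<sigma>\<in>permutations_of_set X. string_weight w \<sigma>) =
    (\<Sum>K\<in>Pow X - {{}}. f (card K) * (\<Sum>\<tau>\<in>permutations_of_set (X - K). string_weight w \<tau>))"
proof -
  let ?I = "\<lambda>\<sigma>. {k. 0 < k \<and> k \<le> length \<sigma> \<and> sorted_wrt (<) (take k \<sigma>)}"
  have "(\<Sum>\<sigma>\<in>permutations_of_set X. string_weight w \<sigma>) =
      (\<Sum>\<sigma>\<in>permutations_of_set X. \<Sum>k\<in>?I \<sigma>. f k * string_weight w (drop k \<sigma>))"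
    using \<open>X \<noteq> {}\<close>
    by (intro sum.cong refl string_weight_convolution w0 w) (auto simp: permutations_of_set_def)
  also have "\<dots> = (\<Sum>(\<sigma>, k)\<in>(SIGMA \<sigma>:permutations_of_set X. ?I \<sigma>). f k * string_weight w (drop k \<sigma>))"
    by (rule sum.Sigma) (auto intro: finite_subset[of _ "{.._}"])
  also have "\<dots> = (\<Sum>(K, \<tau>)\<in>(SIGMA K:Pow X - {{}}. permutations_of_set (X - K)).
      f (card K) * string_weight w \<tau>)"
  proof (rule sum.reindex_bij_witness[where
        i = "\<lambda>(K, \<tau>). (sorted_list_of_set K @ \<tau>, card K)" and
        j = "\<lambda>(\<sigma>, k). (set (take k \<sigma>), drop k \<sigma>)"])
    fix p assume p: "p \<in> (SIGMA \<sigma>:permutations_of_set X. ?I \<sigma>)"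
    obtain \<sigma> k where p_eq: "p = (\<sigma>, k)" by (cases p)
    have k: "0 < k" "k \<le> length \<sigma>" "sorted_wrt (<) (take k \<sigma>)"
      and d: "distinct \<sigma>" "set \<sigma> = X"
      using p by (auto simp: p_eq permutations_of_set_def)
    have c: "card (set (take k \<sigma>)) = k" using d k by (simp add: distinct_card)
    have s: "sorted_list_of_set (set (take k \<sigma>)) = take k \<sigma>"
      using k by (meson sorted_list_of_set.idem_if_sorted_distinct strict_sorted_iff)
    show "(case case p of (\<sigma>, k) \<Rightarrow> (set (take k \<sigma>), drop k \<sigma>) of
        (K, \<tau>) \<Rightarrow> (sorted_list_of_set K @ \<tau>, card K)) = p"
      using c s by (simp add: p_eq)
    have "set (take k \<sigma>) \<union> set (drop k \<sigma>) = X" "set (take k \<sigma>) \<inter> set (drop k \<sigma>) = {}"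
      using d by (metis append_take_drop_id set_append, metis append_take_drop_id distinct_append)
    then have "set (drop k \<sigma>) = X - set (take k \<sigma>)" by blast
    then show "(case p of (\<sigma>, k) \<Rightarrow> (set (take k \<sigma>), drop k \<sigma>)) \<in>
        (SIGMA K:Pow X - {{}}. permutations_of_set (X - K))"
      using d k by (auto simp: p_eq permutations_of_set_def dest: in_set_takeD)
    show "(case case p of (\<sigma>, k) \<Rightarrow> (set (take k \<sigma>), drop k \<sigma>) of
        (K, \<tau>) \<Rightarrow> f (card K) * string_weight w \<tau>) =
        (case p of (\<sigma>, k) \<Rightarrow> f k * string_weight w (drop k \<sigma>))"
      using c by (simp add: p_eq)
  next
    fix q assume q: "q \<in> (SIGMA K:Pow X - {{}}. permutations_of_set (X - K))"
    obtain K \<tau> where q_eq: "q = (K, \<tau>)" by (cases q)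
    have K: "K \<subseteq> X" "K \<noteq> {}" "distinct \<tau>" "set \<tau> = X - K"
      using q by (auto simp: q_eq permutations_of_set_def)
    then have "finite K" using fin finite_subset by blast
    then show "(case case q of (K, \<tau>) \<Rightarrow> (sorted_list_of_set K @ \<tau>, card K) of
        (\<sigma>, k) \<Rightarrow> (set (take k \<sigma>), drop k \<sigma>)) = q"
      by (simp add: q_eq)
    show "(case q of (K, \<tau>) \<Rightarrow> (sorted_list_of_set K @ \<tau>, card K)) \<in>
        (SIGMA \<sigma>:permutations_of_set X. ?I \<sigma>)"
      using K \<open>finite K\<close> by (auto simp: q_eq permutations_of_set_def card_gt_0_iff)
  qed
  also have "\<dots> = (\<Sum>K\<in>Pow X - {{}}. \<Sum>\<tau>\<in>permutations_of_set (X - K). f (card K) * string_weight w \<tau>)"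
    using fin by (subst sum.Sigma) auto
  finally show ?thesis by (simp add: sum_distrib_left)
qed


lemma sum_Pow_card:
  fixes g :: "nat \<Rightarrow> 'a::comm_semiring_1"
  assumes "finite X"
  shows "(\<Sum>K\<in>Pow X. g (card K)) = (\<Sum>k\<le>card X. of_nat (card X choose k) * g k)"
proof -
  have "(\<Sum>K\<in>Pow X. g (card K)) = (\<Sum>k\<le>card X. \<Sum>K\<in>{K \<in> Pow X. card K = k}. g (card K))"
    using assms by (intro sum.group[symmetric]) (auto intro: card_mono)
  also have "\<dots> = (\<Sum>k\<le>card X. of_nat (card {K. K \<subseteq> X \<and> card K = k}) * g k)"
    by (intro sum.cong refl) (simp add: Pow_def)
  finally show ?thesis using assms by (simp add: n_subsets)
qed

text \<open>Both sides satisfy the same recursion: on the left one strips an increasing prefix,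
  whose set of entries is \<open>K\<close>.\<close>

theorem sum_string_weight_eq:
  fixes f w p :: "nat \<Rightarrow> 'a::comm_ring_1"
  assumes w0: "w 0 = 1" and w: "\<And>n. n > 0 \<Longrightarrow> w n = (\<Sum>k\<in>{1..n}. f k * w (n - k))"
    and "f 0 = 0" "p 0 = 1"
    and p: "\<And>n. n > 0 \<Longrightarrow> p n = (\<Sum>k\<le>n. of_nat (n choose k) * (f k * p (n - k)))"
    and "finite X"
  shows "(\<Sum>\<sigma>\<in>permutations_of_set X. string_weight w \<sigma>) = p (card X)"
  using \<open>finite X\<close>
proof (induction X rule: finite_psubset_induct)
  case (psubset X)
  show ?case
  proof (cases "X = {}")
    case True
    then show ?thesis by (simp add: string_weight_Nil \<open>p 0 = 1\<close>)
  next
    case False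
    have "(\<Sum>\<sigma>\<in>permutations_of_set X. string_weight w \<sigma>) =
        (\<Sum>K\<in>Pow X - {{}}. f (card K) * (\<Sum>\<tau>\<in>permutations_of_set (X - K). string_weight w \<tau>))"
      by (rule sum_string_weight_rec) (use w0 w psubset.hyps False in auto)
    also have "\<dots> = (\<Sum>K\<in>Pow X - {{}}. f (card K) * p (card X - card K))"
    proof (intro sum.cong refl)
      fix K assume "K \<in> Pow X - {{}}"
      then have K: "K \<subseteq> X" "X - K \<subset> X" by auto
      then have "card (X - K) = card X - card K"
        using psubset.hyps by (meson card_Diff_subset finite_subset)
      then show "f (card K) * (\<Sum>\<tau>\<in>permutations_of_set (X - K). string_weight w \<tau>) =
          f (card K) * p (card X - card K)"
        using psubset.IH[OF K(2)] by simp
    qed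
    also have "\<dots> = (\<Sum>K\<in>Pow X. f (card K) * p (card X - card K))"
      using psubset.hyps \<open>f 0 = 0\<close> by (intro sum.mono_neutral_left) auto
    also have "\<dots> = (\<Sum>k\<le>card X. of_nat (card X choose k) * (f k * p (card X - k)))"
      using psubset.hyps by (rule sum_Pow_card)
    also have "\<dots> = p (card X)"
      by (rule p[symmetric]) (use False psubset.hyps in \<open>simp add: card_gt_0_iff\<close>)
    finally show ?thesis .
  qed
qed

subsection \<open>Partitions with identity underlying permutation\<close>

text \<open>The composition \<open>xs\<close> as a partition into consecutive intervals of these
  sizes. A part \<open>0\<close> would give an empty block, hence the recurring assumption
  \<open>0 \<notin> set xs\<close>.\<close>

definition blocks :: "nat list \<Rightarrow> nat set list" where
  "blocks xs = map (\<lambda>i. {sum_list (take i xs)<..sum_list (take (Suc i) xs)}) [0..<length xs]"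

lemma length_blocks [simp]: "length (blocks xs) = length xs"
  by (simp add: blocks_def)

lemma blocks_Nil [simp]: "blocks [] = []"
  by (simp add: blocks_def)

lemma blocks_snoc [simp]: "blocks (xs @ [x]) = blocks xs @ [{sum_list xs<..sum_list xs + x}]"
  by (simp add: blocks_def)

lemma map_card_blocks: "map card (blocks xs) = xs"
  by (induction xs rule: rev_induct) auto

lemma finite_blocks: "X \<in> set (blocks xs) \<Longrightarrow> finite X"
  by (auto simp: blocks_def)

lemma Union_blocks: "\<Union> (set (blocks xs)) = {1..sum_list xs}"
  by (induction xs rule: rev_induct) auto

lemma underlying_permutation_blocks: "underlying_permutation (blocks xs) = [1..<sum_list xs + 1]"
proof (induction xs rule: rev_induct)
  case (snoc x xs)
  have "sorted_list_of_set {sum_list xs<..sum_list xs + x} = [Suc (sum_list xs)..<Suc (sum_list xs + x)]"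
    by (metis atLeastSucAtMost_greaterThanAtMost atLeastLessThanSuc_atLeastAtMost
        sorted_list_of_set_range)
  moreover have "[1..<sum_list (xs @ [x]) + 1] =
      [1..<sum_list xs + 1] @ [Suc (sum_list xs)..<Suc (sum_list xs + x)]"
    using upt_add_eq_append[of 1 "Suc (sum_list xs)" x] by simp
  ultimately show ?case using snoc by (simp add: underlying_permutation_def)
qed (simp add: underlying_permutation_def)

lemma ordered_set_partition_blocks:
  assumes "0 \<notin> set xs"
  shows "ordered_set_partition {1..sum_list xs} (blocks xs)"
  using assms
proof (induction xs rule: rev_induct)
  case (snoc x xs)
  let ?B = "{sum_list xs<..sum_list xs + x}"
  have disj: "disjnt ?B (\<Union> (set (blocks xs)))"
    unfolding Union_blocks by (auto simp: disjnt_iff)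
  have ne: "?B \<noteq> {}" using snoc.prems by auto
  have "{1..sum_list (xs @ [x])} - ?B = {1..sum_list xs}" by auto
  moreover have "?B \<notin> set (blocks xs)" using disj ne unfolding disjnt_def by blast
  ultimately show ?case
    using snoc ne unfolding ordered_set_partition_def
    by (auto simp: partition_on_insert[OF disj])
qed (auto simp: ordered_set_partition_def partition_on_def)

text \<open>The block sizes determine such a partition: they say where to cut the list
  \<open>[1..<l + 1]\<close>.\<close>

lemma partitions_with_identity_permutation:
  "{P. ordered_set_partition {1..l} P \<and> underlying_permutation P = [1..<l + 1]} =
     blocks ` {xs. sum_list xs = l \<and> 0 \<notin> set xs}" (is "?L = ?R")
proof (intro equalityI subsetI)
  fix P assume "P \<in> ?L"
  then have P: "partition_on {1..l} (set P)" "underlying_permutation P = [1..<l + 1]"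
    by (auto simp: ordered_set_partition_def)
  have fin: "finite X" "X \<noteq> {}" if "X \<in> set P" for X
    using P(1) that finite_subset[of X "{1..l}"] by (auto simp: partition_on_def)
  define xs where "xs = map card P"
  have sum: "sum_list xs = l"
  proof -
    have "length (underlying_permutation P) = sum_list xs"
      by (simp add: underlying_permutation_def length_concat xs_def comp_def)
    then show ?thesis using P(2) by (simp del: upt_Suc)
  qed
  have pos: "0 \<notin> set xs" using fin by (auto simp: xs_def)
  have "map sorted_list_of_set P = map sorted_list_of_set (blocks xs)"
  \<comment> \<open>Two lists of lists with equal concatenation and equal lengths piece by piece
    coincide.\<close>
  proof (rule iffD1[OF concat_eq_concat_iff])
    show "concat (map sorted_list_of_set P) = concat (map sorted_list_of_set (blocks xs))"
      using P(2) underlying_permutation_blocks[of xs] sum by (simp add: underlying_permutation_def)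
    show len: "length (map sorted_list_of_set P) = length (map sorted_list_of_set (blocks xs))"
      by (simp add: xs_def)
    have "card (P ! i) = card (blocks xs ! i)" if "i < length P" for i
      using that map_card_blocks[of xs] unfolding xs_def by (metis length_blocks length_map nth_map)
    then show "\<forall>(x, y)\<in>set (zip (map sorted_list_of_set P) (map sorted_list_of_set (blocks xs))).
        length x = length y"
      by (auto simp: in_set_zip xs_def)
  qed
  then have "map set (map sorted_list_of_set P) = map set (map sorted_list_of_set (blocks xs))"
    by simp
  moreover have "map set (map sorted_list_of_set Q) = Q" if "\<And>X. X \<in> set Q \<Longrightarrow> finite X"
    for Q :: "nat set list"
    using that by (simp add: map_idI)
  ultimately have "P = blocks xs" using fin finite_blocks by metis
  then show "P \<in> ?R" using sum pos by blast
qed (auto simp: underlying_permutation_blocks simp del: One_nat_def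
      intro: ordered_set_partition_blocks)

text \<open>\<open>map card\<close> inverts \<open>blocks\<close>, so partitions may be counted as
  compositions.\<close>

lemma run_weight_eq_card:
  "run_weight r S l = card {xs. sum_list xs = l \<and> 0 \<notin> set xs \<and> admissible_partition r S (blocks xs)}"
proof -
  have "{P. ordered_set_partition {1..l} P \<and> underlying_permutation P = [1..<l + 1] \<and>
        admissible_partition r S P} =
      blocks ` {xs. sum_list xs = l \<and> 0 \<notin> set xs \<and> admissible_partition r S (blocks xs)}"
    (is "?L = ?R")
  proof -
    have "?L = {P. ordered_set_partition {1..l} P \<and> underlying_permutation P = [1..<l + 1]} \<inter>
        {P. admissible_partition r S P}" by (simp only: Collect_conj_eq Int_assoc)
    also have "\<dots> = ?R" unfolding partitions_with_identity_permutation by auto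
    finally show ?thesis .
  qed
  moreover have "inj blocks" by (metis injI map_card_blocks)
  ultimately show ?thesis
    unfolding run_weight_def by (simp only: card_image[OF inj_on_subset[OF _ subset_UNIV]])
qed

section \<open>The freeze scan on compositions\<close>

lemma blk_blocks:
  assumes "1 \<le> h" "h \<le> length xs"
  shows "blk (blocks xs) h = {sum_list (take (h - 1) xs)<..sum_list (take (h - 1) xs) + xs ! (h - 1)}"
proof -
  have "h - 1 < length xs" "Suc (h - 1) = h" using assms by auto
  then show ?thesis
    using take_Suc_conv_app_nth[of "h - 1" xs] by (simp add: blk_def blocks_def)
qed

lemma card_blk_blocks: "1 \<le> h \<Longrightarrow> h \<le> length xs \<Longrightarrow> card (blk (blocks xs) h) = xs ! (h - 1)"
  by (simp add: blk_blocks)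

text \<open>Consecutive blocks are adjacent intervals, and positivity of the parts makes
  \<open>Max\<close> and \<open>Min\<close> range over nonempty sets.\<close>

lemma collectively_increasing_blocks:
  assumes "0 \<notin> set xs" "1 \<le> i" "j \<le> length xs"
  shows "collectively_increasing (blocks xs) i j"
  unfolding collectively_increasing_def
proof
  fix h assume h: "h \<in> {i..<j}"
  have "0 < xs ! i" if "i < length xs" for i
    using assms(1) that by (metis gr0I nth_mem)
  then have "0 < xs ! (h - 1)" "0 < xs ! h" using h assms by auto
  moreover have "sum_list (take h xs) = sum_list (take (h - 1) xs) + xs ! (h - 1)"
  proof -
    have "h - 1 < length xs" "Suc (h - 1) = h" using h assms by auto
    then show ?thesis using take_Suc_conv_app_nth[of "h - 1" xs] by simp
  qed
  ultimately show "Max (blk (blocks xs) h) < Min (blk (blocks xs) (h + 1))"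
    using h assms by (simp add: blk_blocks)
qed

text \<open>Block \<open>h\<close> sits at list position \<open>h - 1\<close>, so the leading block
  of the tuple is at position \<open>j - r\<close> and its singletons occupy the remaining positions
  below \<open>j\<close>.\<close>

lemma skip_candidate_blocks:
  assumes "0 \<notin> set xs" "j \<le> length xs" "0 < r"
  shows "skip_candidate r (blocks xs) j \<longleftrightarrow>
    r \<le> j \<and> (\<forall>h\<in>{j - r + 1..<j}. xs ! h = 1) \<and> [xs ! (j - r) = 1] (mod r)"
proof (cases "r \<le> j")
  case True
  have "(\<forall>h\<in>{j - r + 2..j}. card (blk (blocks xs) h) = 1) \<longleftrightarrow> (\<forall>h\<in>{j - r + 2..j}. xs ! (h - 1) = 1)"
    using assms by (intro ball_cong) (auto simp: card_blk_blocks)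
  also have "\<dots> \<longleftrightarrow> (\<forall>h\<in>Suc ` {j - r + 1..<j}. xs ! (h - 1) = 1)"
    by (simp add: atLeastLessThanSuc_atLeastAtMost)
  also have "\<dots> \<longleftrightarrow> (\<forall>h\<in>{j - r + 1..<j}. xs ! h = 1)"
    by (simp only: ball_simps diff_Suc_1)
  finally have singletons: "(\<forall>h\<in>{j - r + 2..j}. card (blk (blocks xs) h) = 1) \<longleftrightarrow>
      (\<forall>h\<in>{j - r + 1..<j}. xs ! h = 1)" .
  have "card (blk (blocks xs) (j - r + 1)) = xs ! (j - r)"
    using assms True card_blk_blocks[of "j - r + 1" xs] by simp
  moreover have "collectively_increasing (blocks xs) (j - r + 1) j"
    using assms by (intro collectively_increasing_blocks) auto
  ultimately show ?thesis
    by (simp only: skip_candidate_def singletons simp_thms)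
qed (simp add: skip_candidate_def)

lemma freeze_scan_subset: "X \<in> freeze_scan r S P j \<Longrightarrow> X \<subseteq> {1..j}"
proof (induction j rule: less_induct)
  case (less j)
  show ?case
  proof (cases "X \<in> freeze_scan r S P (j - r) \<or> X \<in> freeze_scan r S P (j - 1)")
    case True
    moreover have "r \<noteq> 0" "j \<noteq> 0"
      using less.prems by (auto simp: freeze_scan.simps[of r S P j] split: if_splits)
    ultimately show ?thesis using less.IH[of "j - r"] less.IH[of "j - 1"] by fastforce
  next
    case False
    then show ?thesis using less.prems
      by (auto simp: freeze_scan.simps[of r S P j] skip_candidate_def split: if_splits)
  qed
qed

text \<open>A scan started at \<open>j\<close> only inspects blocks up to \<open>j\<close>. Hence a
  scan that has worked through an appended tail continues as it would on \<open>xs\<close>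
  alone.\<close>

lemma freeze_scan_append:
  assumes "0 \<notin> set (xs @ ys)" "j \<le> length xs"
  shows "freeze_scan r S (blocks (xs @ ys)) j = freeze_scan r S (blocks xs) j"
  using assms(2)
proof (induction j rule: less_induct)
  case (less j)
  show ?case
  proof (cases "r = 0 \<or> j = 0")
    case False
    have cand: "skip_candidate r (blocks (xs @ ys)) j \<longleftrightarrow> skip_candidate r (blocks xs) j"
      using less.prems False assms(1)
      by (auto simp: skip_candidate_blocks nth_append)
    have card: "card (blk (blocks (xs @ ys)) (j - r + 1)) = card (blk (blocks xs) (j - r + 1))"
    proof -
      have "j - r < length xs" "j - r + 1 \<le> length xs" using less.prems False by linarith+
      then show ?thesis by (simp add: card_blk_blocks nth_append)
    qed
    show ?thesis
      using less.IH[of "j - r"] less.IH[of "j - 1"] less.prems False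
      by (simp add: freeze_scan.simps[of r S _ j] cand card[unfolded Suc_eq_plus1[symmetric]])
  qed (auto simp: freeze_scan.simps)
qed


text \<open>Block numbers start from 1, so list position \<open>i\<close> corresponds to the element
  \<open>Suc i\<close>.\<close>

definition frozen :: "nat \<Rightarrow> nat set \<Rightarrow> nat list \<Rightarrow> nat set" where
  "frozen r S xs = \<Union> (freeze_scan r S (blocks xs) (length xs))"

lemma frozen_subset: "frozen r S xs \<subseteq> {1..length xs}"
  using freeze_scan_subset unfolding frozen_def by blast

subsection \<open>Admissible compositions\<close>

text \<open>\<open>S\<close> stands for \<open>A \<union> B\<close>; the two sets can be told apart
  by the residue modulo \<open>r\<close>.\<close>

locale odd_ended_set =
  fixes r :: nat and S :: "nat set"
  assumes r: "r > 2" and S_subset: "S \<subseteq> Nstar r" and one_in: "1 \<in> S" and odd: "odd_ended r S"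
begin

section \<open>Tops and bottoms as residues\<close>

lemma Nstar_iff: "x \<in> Nstar r \<longleftrightarrow> x \<ge> 1 \<and> (x mod r = 0 \<or> x mod r = 1)"
  using r by (auto simp: Nstar_def cong_def)

lemma Nstar_cases:
  assumes "x \<in> Nstar r"
  obtains k where "k > 0" "x = k * r" | k where "x = k * r + 1"
proof -
  have "x = (x div r) * r + x mod r" by simp
  moreover have "x mod r = 0 \<or> x mod r = 1" "x \<ge> 1" using assms by (auto simp: Nstar_iff)
  ultimately show ?thesis
    using that by (metis add.right_neutral gr0I mult_0 not_one_le_zero)
qed

lemma multiple_in_Nstar: "k > 0 \<Longrightarrow> k * r \<in> Nstar r" and Suc_multiple_in_Nstar: "k * r + 1 \<in> Nstar r"
  using r by (auto simp: Nstar_iff mod_Suc)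

text \<open>The gap that identifies the successor of \<open>k * r + 1\<close> and the predecessor of
  \<open>Suc k * r\<close> in \<open>Nstar r\<close>.\<close>

lemma no_Nstar_between:
  assumes "y \<in> Nstar r" "k * r + 1 < y" shows "Suc k * r \<le> y"
  using assms(1)
proof (cases rule: Nstar_cases)
  case (1 q)
  then have "k < q" using assms(2) r by (metis add_lessD1 mult_less_cancel2)
  then have "Suc k \<le> q" by simp
  then show ?thesis using 1 mult_le_mono1 by blast
next
  case (2 q)
  then have "k < q" using assms(2) r by (metis add_less_cancel_right mult_less_cancel2)
  then have "Suc k \<le> q" by simp
  then show ?thesis using 2 mult_le_mono1 by (metis le_add1 le_trans)
qed

lemma Nstar_Least_after_Suc_multiple:
  "(LEAST y. y \<in> Nstar r \<and> k * r + 1 < y) = Suc k * r"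
proof (rule Least_equality)
  show "Suc k * r \<in> Nstar r \<and> k * r + 1 < Suc k * r"
    using multiple_in_Nstar[of "Suc k"] r by simp
qed (use no_Nstar_between in blast)

lemma Nstar_Least_after_multiple:
  assumes "k > 0" shows "(LEAST y. y \<in> Nstar r \<and> k * r < y) = k * r + 1"
  by (rule Least_equality) (use Suc_multiple_in_Nstar in auto)

lemma Nstar_Greatest_before_multiple:
  "(GREATEST y. y \<in> Nstar r \<and> y < Suc k * r) = k * r + 1"
proof (rule Greatest_equality)
  show "k * r + 1 \<in> Nstar r \<and> k * r + 1 < Suc k * r"
    using Suc_multiple_in_Nstar r by simp
  show "y \<le> k * r + 1" if "y \<in> Nstar r \<and> y < Suc k * r" for y
    using that no_Nstar_between[of y k] by linarith
qed

lemma Nstar_Greatest_before_Suc_multiple: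
  assumes "k > 0" shows "(GREATEST y. y \<in> Nstar r \<and> y < k * r + 1) = k * r"
  by (rule Greatest_equality) (use multiple_in_Nstar[OF assms] in auto)

text \<open>The maximal interval around a multiple of \<open>r\<close> cannot end there.\<close>

lemma neighbours_in_S:
  assumes "Suc k * r \<in> S"
  shows "Suc k * r + 1 \<in> S" "k * r + 1 \<in> S"
proof -
  let ?x = "Suc k * r"
  \<comment> \<open>The maximal interval through \<open>?x\<close>: all \<open>y\<close> such that
    every element of \<open>Nstar r\<close> between \<open>y\<close> and \<open>?x\<close> lies in
    \<open>S\<close>.\<close>
  define I where "I = {y \<in> Nstar r. \<forall>z\<in>Nstar r. (y \<le> z \<and> z \<le> ?x) \<or> (?x \<le> z \<and> z \<le> y) \<longrightarrow> z \<in> S}"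
  have x: "?x \<in> I" using assms S_subset by (auto simp: I_def)
  have sub: "I \<subseteq> S"
    unfolding I_def by auto
  have int: "Nstar_interval r I"
    unfolding Nstar_interval_def
  proof (intro conjI ballI impI)
    fix a b y assume a: "a \<in> I" "b \<in> I" "y \<in> Nstar r" "a \<le> y \<and> y \<le> b"
    show "y \<in> I" unfolding I_def
    proof (intro CollectI conjI ballI impI)
      fix z assume z: "z \<in> Nstar r" "(y \<le> z \<and> z \<le> ?x) \<or> (?x \<le> z \<and> z \<le> y)"
      then have "(a \<le> z \<and> z \<le> ?x) \<or> (?x \<le> z \<and> z \<le> b)" using a(4) by linarith
      then show "z \<in> S" using a(1,2) z(1) unfolding I_def by blast
    qed (use a in simp)
  qed (use x in \<open>auto simp: I_def\<close>)
  have max: "maximal_interval r S I"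
    unfolding maximal_interval_def
  proof (intro conjI allI impI int sub)
    fix J assume J: "Nstar_interval r J \<and> J \<subseteq> S \<and> I \<subseteq> J"
    have "y \<in> I" if "y \<in> J" for y
      using that J x unfolding I_def Nstar_interval_def by blast
    then show "J = I" using J by blast
  qed
  \<comment> \<open>Endpoints are congruent to 1, so \<open>?x\<close> is none; a missing neighbour
    would make it the largest or least element of \<open>I\<close>.\<close>
  have not_cong: "\<not> [?x = 1] (mod r)" using r by (simp add: cong_def)
  then have not_end: "\<not> is_endpoint ?x I"
    using odd max unfolding odd_ended_def by blast
  show "Suc k * r + 1 \<in> S"
  proof (rule ccontr)
    assume n: "Suc k * r + 1 \<notin> S"
    have "y \<le> ?x" if "y \<in> I" for y
    proof (rule ccontr)
      assume "\<not> y \<le> ?x"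
      then have "?x \<le> ?x + 1" "?x + 1 \<le> y" by auto
      then show False using that n Suc_multiple_in_Nstar[of "Suc k"] unfolding I_def by blast
    qed
    then show False using not_end x unfolding is_endpoint_def by blast
  qed
  show "k * r + 1 \<in> S"
  proof (rule ccontr)
    assume n: "k * r + 1 \<notin> S"
    have "?x \<le> y" if "y \<in> I" for y
    proof (rule ccontr)
      assume "\<not> ?x \<le> y"
      moreover have "y \<in> Nstar r" using that by (simp add: I_def)
      ultimately have "y \<le> k * r + 1" using no_Nstar_between[of y k] by linarith
      moreover have "k * r + 1 \<le> ?x" using r by simp
      ultimately show False using that n Suc_multiple_in_Nstar[of k] unfolding I_def by blast
    qed
    then show False using not_end x unfolding is_endpoint_def by blast
  qed
qed

lemma zero_notin: "0 \<notin> S"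
  using S_subset by (auto simp: Nstar_iff)

lemma not_top_multiple: "\<not> is_top r S (k * r)"
proof (cases k)
  case (Suc q)
  then show ?thesis
    using neighbours_in_S[of q] Nstar_Least_after_multiple[of k] by (auto simp: is_top_def)
qed (simp add: is_top_def zero_notin)

lemma not_bottom_multiple: "\<not> is_bottom r S (k * r)"
proof (cases k)
  case (Suc q)
  moreover have "Suc q * r \<noteq> 1" using r by simp
  ultimately show ?thesis
    using neighbours_in_S[of q] Nstar_Greatest_before_multiple[of q] unfolding is_bottom_def by metis
qed (simp add: is_bottom_def zero_notin)

lemma is_top_iff: "is_top r S (k * r + 1) \<longleftrightarrow> k * r + 1 \<in> S \<and> Suc k * r \<notin> S"
  using Nstar_Least_after_Suc_multiple[of k] unfolding is_top_def by metis

lemma is_bottom_iff: "is_bottom r S (k * r + 1) \<longleftrightarrow> k * r + 1 \<in> S \<and> (k = 0 \<or> k * r \<notin> S)"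
proof (cases "k = 0")
  case False
  then show ?thesis
    using Nstar_Greatest_before_Suc_multiple[of k] r unfolding is_bottom_def by simp
qed (simp add: is_bottom_def)

lemma bottom_1: "is_bottom r S 1"
  using one_in by (simp add: is_bottom_def)

lemma top_or_bottom_cong:
  assumes "is_top r S x \<or> is_bottom r S x" shows "[x = 1] (mod r)"
proof -
  have "x \<in> Nstar r" using assms S_subset by (auto simp: is_top_def is_bottom_def)
  then show ?thesis
    using assms not_top_multiple not_bottom_multiple
    by (cases rule: Nstar_cases) (auto simp: cong_def mod_Suc)
qed


section \<open>The effect of appending a tail\<close>

abbreviation adm :: "nat list \<Rightarrow> bool" where
  "adm xs \<equiv> admissible_partition r S (blocks xs)"

text \<open>The definition in terms of list positions. The alternative of size 1 is absorbed because
  1 is always a bottom, and \<open>{i<..<i + r}\<close> holds the \<open>r - 1\<close> positions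
  after \<open>i\<close>.\<close>

lemma adm_iff:
  "adm xs \<longleftrightarrow>
     (\<forall>x\<in>set xs. is_top r S x \<or> is_bottom r S x) \<and>
     (\<forall>i<length xs. is_top r S (xs ! i) \<and> \<not> is_bottom r S (xs ! i) \<longrightarrow> Suc i \<in> frozen r S xs) \<and>
     (\<forall>i. i + r \<le> length xs \<longrightarrow> is_bottom r S (xs ! i) \<and> \<not> is_top r S (xs ! i) \<longrightarrow>
        (\<exists>h\<in>{i<..<i + r}. xs ! h \<noteq> 1 \<or> Suc h \<in> frozen r S xs))"
  (is "_ \<longleftrightarrow> ?A \<and> ?B \<and> ?C")
proof -
  let ?P = "blocks xs" and ?t = "is_top r S" and ?b = "is_bottom r S"
  have shift: "(\<forall>i\<in>{1..length xs}. Q i) \<longleftrightarrow> (\<forall>i<length xs. Q (Suc i))" for Q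
    by (metis One_nat_def Suc_le_eq Suc_pred atLeastAtMost_iff zero_less_Suc)
  have card: "card (blk ?P (Suc i)) = xs ! i" if "i < length xs" for i
    using that card_blk_blocks[of "Suc i" xs] by simp
  have A: "(\<forall>i\<in>{1..length xs}. card (blk ?P i) = 1 \<or> ?t (card (blk ?P i)) \<or> ?b (card (blk ?P i)))
      \<longleftrightarrow> ?A"
    unfolding shift all_set_conv_all_nth using bottom_1 by (auto simp: card)
  have B: "(\<forall>i\<in>{1..length xs}. ?t (card (blk ?P i)) \<and> \<not> ?b (card (blk ?P i)) \<longrightarrow>
      in_freeze_skip r S ?P i) \<longleftrightarrow> ?B"
    unfolding shift by (auto simp: card in_freeze_skip_def frozen_def)
  have window: "(\<forall>h\<in>{Suc i + 1..Suc i + (r - 1)}. card (blk ?P h) = 1 \<and> \<not> in_freeze_skip r S ?P h)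
      \<longleftrightarrow> (\<forall>h\<in>{i<..<i + r}. xs ! h = 1 \<and> Suc h \<notin> frozen r S xs)" if "i + r \<le> length xs" for i
  proof -
    have "{Suc i + 1..Suc i + (r - 1)} = Suc ` {i<..<i + r}"
    proof -
      have "Suc i + (r - 1) = i + r" using r by simp
      then show ?thesis
        by (simp only: image_Suc_atLeastLessThan atLeastSucLessThan_greaterThanLessThan[symmetric]
            atLeastLessThanSuc_atLeastAtMost Suc_eq_plus1[symmetric])
    qed
    then show ?thesis using that by (auto simp: card in_freeze_skip_def frozen_def)
  qed
  have "(\<exists>i\<in>{1..length xs}. ?b (card (blk ?P i)) \<and> \<not> ?t (card (blk ?P i)) \<and>
        i + (r - 1) \<le> length xs \<and>
        (\<forall>h\<in>{i + 1..i + (r - 1)}. card (blk ?P h) = 1 \<and> \<not> in_freeze_skip r S ?P h)) \<longleftrightarrow>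
      (\<exists>i<length xs. ?b (xs ! i) \<and> \<not> ?t (xs ! i) \<and> i + r \<le> length xs \<and>
        (\<forall>h\<in>{i<..<i + r}. xs ! h = 1 \<and> Suc h \<notin> frozen r S xs))" (is "(\<exists>i\<in>_. ?Q i) \<longleftrightarrow> (\<exists>i<_. ?R i)")
  proof -
    have "?Q (Suc i) \<longleftrightarrow> ?R i" if "i < length xs" for i
    proof -
      have "Suc i + (r - 1) = i + r" using r by simp
      then show ?thesis using window[of i] card[OF that] by auto
    qed
    then show ?thesis using shift[of "\<lambda>i. \<not> ?Q i"] by blast
  qed
  also have "\<dots> \<longleftrightarrow> \<not> ?C" using r by fastforce
  finally show ?thesis unfolding admissible_partition_def length_blocks A B by blast
qed

text \<open>By \<open>hd\<close> the first new part is not an unfrozen singleton, so a window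
  reaching from \<open>xs\<close> into \<open>zs\<close> cannot violate the third condition. Since
  \<open>zs\<close> has at most \<open>r\<close> parts, the only other new window starts with
  \<open>zs\<close> and needs exactly \<open>r\<close> parts.\<close>

lemma adm_append:
  assumes zs: "zs \<noteq> []" "length zs \<le> r"
    and hd: "zs ! 0 \<noteq> 1 \<or> Suc (length xs) \<in> frozen r S (xs @ zs)"
    and frozen: "\<And>i. i \<le> length xs \<Longrightarrow> i \<in> frozen r S (xs @ zs) \<longleftrightarrow> i \<in> frozen r S xs"
  shows "adm (xs @ zs) \<longleftrightarrow> adm xs \<and>
     (\<forall>x\<in>set zs. is_top r S x \<or> is_bottom r S x) \<and>
     (\<forall>i<length zs. is_top r S (zs ! i) \<and> \<not> is_bottom r S (zs ! i) \<longrightarrow>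
        Suc (length xs + i) \<in> frozen r S (xs @ zs)) \<and>
     (length zs = r \<longrightarrow> is_bottom r S (zs ! 0) \<and> \<not> is_top r S (zs ! 0) \<longrightarrow>
        (\<exists>h\<in>{0<..<r}. zs ! h \<noteq> 1 \<or> Suc (length xs + h) \<in> frozen r S (xs @ zs)))"
proof -
  let ?n = "length xs" and ?ys = "xs @ zs"
  let ?Q = "\<lambda>ys i. is_top r S (ys ! i) \<and> \<not> is_bottom r S (ys ! i) \<longrightarrow> Suc i \<in> frozen r S ys"
  let ?R = "\<lambda>ys i. is_bottom r S (ys ! i) \<and> \<not> is_top r S (ys ! i) \<longrightarrow>
        (\<exists>h\<in>{i<..<i + r}. ys ! h \<noteq> 1 \<or> Suc h \<in> frozen r S ys)"
  have split: "(\<forall>i<length ?ys. X i) \<longleftrightarrow> (\<forall>i<?n. X i) \<and> (\<forall>i<length zs. X (?n + i))" for X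
  proof (intro iffI conjI allI impI)
    fix i assume *: "(\<forall>i<?n. X i) \<and> (\<forall>i<length zs. X (?n + i))" "i < length ?ys"
    show "X i"
    proof (cases "i < ?n")
      case False
      then have "i - ?n < length zs" "?n + (i - ?n) = i" using *(2) by auto
      then show ?thesis using * by metis
    qed (use * in blast)
  qed auto
  have Q: "(\<forall>i<length ?ys. ?Q ?ys i) \<longleftrightarrow> (\<forall>i<?n. ?Q xs i) \<and>
      (\<forall>i<length zs. is_top r S (zs ! i) \<and> \<not> is_bottom r S (zs ! i) \<longrightarrow>
        Suc (?n + i) \<in> frozen r S ?ys)"
    unfolding split using frozen by (auto simp: nth_append Suc_le_eq)
  have R_old: "?R ?ys i \<longleftrightarrow> ?R xs i" if "i + r \<le> ?n" for i
    using that r frozen by (auto simp: nth_append)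
  \<comment> \<open>Such a window contains position \<open>?n\<close>, and \<open>hd\<close> makes
    that position a witness.\<close>
  have R_mid: "?R ?ys i" if "i < ?n" "?n < i + r" for i
  proof -
    have "?ys ! ?n \<noteq> 1 \<or> Suc ?n \<in> frozen r S ?ys" using hd by (simp add: nth_append)
    then show ?thesis using that by (metis greaterThanLessThan_iff)
  qed
  have R_last: "?R ?ys ?n \<longleftrightarrow> (is_bottom r S (zs ! 0) \<and> \<not> is_top r S (zs ! 0) \<longrightarrow>
        (\<exists>h\<in>{0<..<r}. zs ! h \<noteq> 1 \<or> Suc (?n + h) \<in> frozen r S ?ys))"
  proof -
    have "(\<exists>h\<in>{?n<..<?n + r}. X h) \<longleftrightarrow> (\<exists>h\<in>{0<..<r}. X (?n + h))" (is "?L \<longleftrightarrow> ?R") for X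
    proof
      assume ?L
      then obtain h where "h \<in> {?n<..<?n + r}" "X h" by blast
      then show ?R by (intro bexI[of _ "h - ?n"]) auto
    next
      assume ?R
      then obtain h where "h \<in> {0<..<r}" "X (?n + h)" by blast
      then show ?L by (intro bexI[of _ "?n + h"]) auto
    qed
    then show ?thesis by (simp add: nth_append)
  qed
  have R: "(\<forall>i. i + r \<le> length ?ys \<longrightarrow> ?R ?ys i) \<longleftrightarrow>
      (\<forall>i. i + r \<le> ?n \<longrightarrow> ?R xs i) \<and> (length zs = r \<longrightarrow> ?R ?ys ?n)"
    (is "?all \<longleftrightarrow> ?old \<and> ?last")
  proof (intro iffI conjI)
    assume all: ?all
    show ?old
    proof (rule allI, rule impI)
      fix i assume "i + r \<le> ?n"
      moreover from this have "i + r \<le> length ?ys" by simp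
      ultimately show "?R xs i" using all R_old by blast
    qed
    show ?last
    proof (rule impI)
      assume "length zs = r"
      then show "?R ?ys ?n" using all by simp
    qed
  next
    assume *: "?old \<and> ?last"
    show ?all
    proof (rule allI, rule impI)
      fix i assume "i + r \<le> length ?ys"
      then consider "i + r \<le> ?n" | "i < ?n" "?n < i + r" | "i = ?n" "length zs = r"
        using zs(2) by fastforce
      then show "?R ?ys i"
      proof cases
        case 1
        then show ?thesis using * R_old[OF 1] by blast
      next
        case 2
        then show ?thesis by (rule R_mid)
      next
        case 3
        then show ?thesis using * by blast
      qed
    qed
  qed
  show ?thesis
    unfolding adm_iff[of ?ys] adm_iff[of xs] Q R R_last set_append ball_Un by blast
qed

text \<open>Before the scan reaches the end of \<open>xs\<close>, every candidate would have
  \<open>c\<close> among its \<open>r - 1\<close> required singletons, which \<open>c > 1\<close>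
  forbids.\<close>

lemma frozen_append_short:
  assumes "0 \<notin> set xs" "c > 1" "m < r - 1"
  shows "frozen r S (xs @ c # replicate m 1) = frozen r S xs"
proof -
  let ?ys = "xs @ c # replicate m 1"
  have pos: "0 \<notin> set ?ys" using assms by auto
  have "freeze_scan r S (blocks ?ys) (length xs + k) = freeze_scan r S (blocks ?ys) (length xs)"
    if "k \<le> Suc m" for k
    using that
  proof (induction k)
    case (Suc k)
    have "\<not> skip_candidate r (blocks ?ys) (length xs + Suc k)"
    proof
      assume "skip_candidate r (blocks ?ys) (length xs + Suc k)"
      then have "r \<le> length xs + Suc k"
        "\<forall>h\<in>{length xs + Suc k - r + 1..<length xs + Suc k}. ?ys ! h = 1"
        using Suc.prems r skip_candidate_blocks[OF pos] by auto
      moreover have "length xs \<in> {length xs + Suc k - r + 1..<length xs + Suc k}"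
        using Suc.prems assms(3) calculation(1) by auto
      ultimately have "?ys ! length xs = 1" by blast
      then show False using assms(2) by simp
    qed
    then show ?case using r Suc by (simp add: freeze_scan.simps[of r S _ "Suc (length xs + k)"])
  qed simp
  from this[of "Suc m"] show ?thesis
    unfolding frozen_def using freeze_scan_append[OF pos, of "length xs"] by simp
qed

lemma skip_candidate_append:
  assumes "0 \<notin> set xs" "c > 0"
  shows "skip_candidate r (blocks (xs @ c # replicate (r - 1) 1)) (length xs + r) \<longleftrightarrow> [c = 1] (mod r)"
proof -
  have "(xs @ c # replicate (r - 1) 1) ! h = 1" if "length xs < h" "h < length xs + r" for h
    using that r by (auto simp: nth_append nth_Cons')
  then show ?thesis
    using assms r by (subst skip_candidate_blocks) auto
qed

text \<open>The scan meets this candidate first. If \<open>c\<close> is a top it records the tuple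
  and proceeds into \<open>xs\<close>; otherwise it stops at once, so that nothing is frozen, not
  even inside \<open>xs\<close>.\<close>

lemma frozen_append_tuple:
  assumes "0 \<notin> set xs" "[c = 1] (mod r)" "c > 0"
  shows "frozen r S (xs @ c # replicate (r - 1) 1) =
    (if is_top r S c then {Suc (length xs)..length xs + r} \<union> frozen r S xs else {})"
proof -
  let ?ys = "xs @ c # replicate (r - 1) 1"
  have pos: "0 \<notin> set ?ys" using assms by auto
  have len: "length ?ys = length xs + r" using r by simp
  have "card (blk (blocks ?ys) (Suc (length xs))) = c"
    using card_blk_blocks[of "Suc (length xs)" ?ys] by simp
  then show ?thesis
    using skip_candidate_append[OF assms(1,3)] assms(2) r freeze_scan_append[OF pos, of "length xs" r S]
    unfolding frozen_def len by (simp add: freeze_scan.simps[of r S _ "length xs + r"])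
qed

lemma adm_replicate:
  assumes "m < r" shows "adm (replicate m 1)"
  unfolding adm_iff using assms bottom_1 by auto

lemma adm_append_short:
  assumes "0 \<notin> set xs" "c > 1" "m < r - 1"
  shows "adm (xs @ c # replicate m 1) \<longleftrightarrow> adm xs \<and> is_bottom r S c"
proof -
  have "Suc (length xs + i) \<notin> frozen r S xs" for i
    using frozen_subset[of r S xs] by auto
  then show ?thesis
    using assms bottom_1
    by (subst adm_append) (auto simp: frozen_append_short nth_Cons' simp del: One_nat_def)
qed

text \<open>If \<open>c\<close> is a top, the new blocks are all frozen and satisfy every condition.
  Otherwise admissibility would make \<open>c\<close> a bottom, hence congruent to 1; the scan then
  stops immediately, and \<open>c\<close> is followed by \<open>r - 1\<close> unfrozen singletons,
  which is forbidden.\<close>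

lemma adm_append_tuple:
  assumes "0 \<notin> set xs" "c > 0"
  shows "adm (xs @ c # replicate (r - 1) 1) \<longleftrightarrow> adm xs \<and> is_top r S c"
proof (cases "is_top r S c")
  case True
  then have frozen: "frozen r S (xs @ c # replicate (r - 1) 1) =
      {Suc (length xs)..length xs + r} \<union> frozen r S xs"
    using frozen_append_tuple assms top_or_bottom_cong by simp
  show ?thesis
    using True r bottom_1
    by (subst adm_append) (auto simp: frozen nth_Cons' simp del: One_nat_def)
next
  case False
  let ?ys = "xs @ c # replicate (r - 1) 1"
  have "\<not> adm ?ys"
  proof
    assume a: "adm ?ys"
    then have b: "is_bottom r S c" using False unfolding adm_iff by auto
    then have "frozen r S ?ys = {}"
      using frozen_append_tuple assms top_or_bottom_cong False by simp
    moreover have "length xs + r \<le> length ?ys" "?ys ! length xs = c" using r by auto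
    ultimately obtain h where "h \<in> {length xs<..<length xs + r}" "?ys ! h \<noteq> 1"
      using a b False unfolding adm_iff by (metis empty_iff)
    then show False using r by (auto simp: nth_append nth_Cons' split: if_splits)
  qed
  then show ?thesis using False by simp
qed


text \<open>Count the trailing ones. If at least \<open>r - 1\<close> of them follow another part,
  \<open>c\<close> is the \<open>r\<close>-th part from the right, possibly 1 itself; otherwise an
  earlier part above 1 serves as \<open>c\<close>, or the list consists of fewer than
  \<open>r\<close> ones.\<close>

lemma composition_cases:
  assumes "0 \<notin> set (xs :: nat list)"
  obtains m where "m < r" "xs = replicate m 1"
    | ys c m where "xs = ys @ c # replicate m 1" "m < r - 1" "c > 1"
    | ys c where "xs = ys @ c # replicate (r - 1) 1" "c > 0"
proof -
  have "(\<exists>m<r. xs = replicate m 1) \<or>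
      (\<exists>ys c m. xs = ys @ c # replicate m 1 \<and> m < r - 1 \<and> c > 1) \<or>
      (\<exists>ys c. xs = ys @ c # replicate (r - 1) 1 \<and> c > 0)"
    (is "?A xs \<or> ?B xs \<or> ?C xs")
    using assms
  proof (induction xs rule: rev_induct)
    case Nil
    have "[] = replicate 0 1" by simp
    then show ?case using r by (metis less_trans zero_less_numeral)
  next
    case (snoc x xs)
    have rep: "replicate k 1 @ [1] = replicate (Suc k) (1::nat)" for k
      by (simp add: replicate_append_same)
    show ?case
    proof (cases "x = 1")
      case False
      then have "xs @ [x] = xs @ x # replicate 0 1" "0 < r - 1" "x > 1"
        using r snoc.prems by auto
      then show ?thesis by blast
    next
      case True
      consider m where "m < r" "xs = replicate m 1"
        | ys c m where "xs = ys @ c # replicate m 1" "m < r - 1" "c > 1"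
        | ys c where "xs = ys @ c # replicate (r - 1) 1" "c > 0"
        using snoc.IH snoc.prems by auto
      then show ?thesis
      proof cases
        case (1 m)
        then have eq: "xs @ [x] = replicate (Suc m) 1" using True rep by simp
        show ?thesis
        proof (cases "Suc m < r")
          case False
          \<comment> \<open>With exactly \<open>r\<close> ones, the first of them takes the role of
            \<open>c\<close>.\<close>
          then have "Suc m = Suc (r - 1)" using 1(1) by simp
          then have "xs @ [x] = [] @ 1 # replicate (r - 1) 1" using eq by simp
          then show ?thesis by (metis zero_less_one)
        qed (use eq in blast)
      next
        case (2 ys c m)
        then have eq: "xs @ [x] = ys @ c # replicate (Suc m) 1" using True rep[of m] by simp
        show ?thesis
        proof (cases "Suc m < r - 1")
          case False
          then have "Suc m = r - 1" using 2(2) by simp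
          then have "xs @ [x] = ys @ c # replicate (r - 1) 1" "c > 0" using eq 2(3) by auto
          then show ?thesis by blast
        qed (use eq 2(3) in blast)
      next
        case (3 ys c)
        \<comment> \<open>With one more trailing one, the old \<open>c\<close> joins the prefix and
          the first of the ones becomes the new \<open>c\<close>.\<close>
        have "xs @ [x] = ys @ c # replicate (Suc (r - 1)) 1"
          unfolding 3(1) using True rep[of "r - 1"] by simp
        then have "xs @ [x] = (ys @ [c]) @ 1 # replicate (r - 1) 1" by simp
        then show ?thesis by (metis zero_less_one)
      qed
    qed
  qed
  then show ?thesis using that by blast
qed

section \<open>Counting admissible compositions by their tails\<close>

definition adm_compositions :: "nat \<Rightarrow> nat list set" where
  "adm_compositions n = {xs. sum_list xs = n \<and> 0 \<notin> set xs \<and> adm xs}"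

text \<open>A pair \<open>(c, m)\<close> encodes the tail \<open>c\<close> followed by
  \<open>m\<close> ones; \<open>k\<close> is its total size.\<close>

definition tails :: "nat \<Rightarrow> (nat \<times> nat) set" where
  "tails k = {(c, m). c + m = k \<and> (m < r - 1 \<and> c > 1 \<and> is_bottom r S c \<or> m = r - 1 \<and> is_top r S c)}"

lemma finite_tails: "finite (tails k)"
  by (rule finite_subset[of _ "{..k} \<times> {..k}"]) (auto simp: tails_def)

lemma finite_adm_compositions: "finite (adm_compositions n)"
proof (rule finite_subset)
  show "adm_compositions n \<subseteq> {xs. set xs \<subseteq> {..n} \<and> length xs \<le> n}"
  proof
    fix xs assume "xs \<in> adm_compositions n"
    then have xs: "sum_list xs = n" "0 \<notin> set xs" by (auto simp: adm_compositions_def)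
    have "length xs = sum_list (map (\<lambda>_. 1) xs)" by (simp add: sum_list_triv)
    also have "\<dots> \<le> sum_list (map (\<lambda>x. x) xs)"
      using xs(2) by (intro sum_list_mono) (metis One_nat_def Suc_leI gr0I)
    finally show "xs \<in> {xs. set xs \<subseteq> {..n} \<and> length xs \<le> n}"
      using xs(1) member_le_sum_list by fastforce
  qed
qed (rule finite_lists_length_le, simp)

lemma top_or_bottom_pos: "is_top r S c \<or> is_bottom r S c \<Longrightarrow> c > 0"
  using zero_notin by (auto simp: is_top_def is_bottom_def intro: gr0I)

text \<open>\<open>U\<close> collects the short lists of ones, and \<open>g\<close> attaches a tail
  of size \<open>k\<close> to an admissible composition of \<open>n - k\<close>. The count follows
  because \<open>g\<close> is injective and its image avoids \<open>U\<close>.\<close>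

lemma card_adm_compositions:
  "card (adm_compositions n) =
     (if n < r then 1 else 0) + (\<Sum>k\<le>n. card (tails k) * card (adm_compositions (n - k)))"
proof -
  define D where "D = (SIGMA k:{..n}. tails k \<times> adm_compositions (n - k))"
  define g :: "nat \<times> (nat \<times> nat) \<times> nat list \<Rightarrow> nat list" where
    "g = (\<lambda>(k, (c, m), xs). xs @ c # replicate m 1)"
  define U where "U = (if n < r then {replicate n (1::nat)} else {})"
  have finD: "finite D"
    unfolding D_def by (intro finite_SigmaI) (auto simp: finite_tails finite_adm_compositions)
  have lt: "m < r \<and> (m = r - 1 \<or> c > 1)" if "(c, m) \<in> tails k" for c m k
    using that r by (auto simp: tails_def)
  have inj: "inj_on g D"
  proof (rule inj_onI)
    fix p q assume pq: "p \<in> D" "q \<in> D" "g p = g q"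
    obtain k c m xs k' c' m' xs' where p: "p = (k, (c, m), xs)" and q: "q = (k', (c', m'), xs')"
      by (metis prod.collapse)
    have t: "(c, m) \<in> tails k" "(c', m') \<in> tails k'" using pq p q by (auto simp: D_def)
    have eq: "rev (xs @ c # replicate m 1) = rev (xs' @ c' # replicate m' 1)"
      using pq(3) by (simp add: p q g_def)
    \<comment> \<open>Reading from the right, entry \<open>a\<close> is \<open>d\<close> in one list
      and a one in the other. As \<open>a < b < r\<close> rules out \<open>a = r - 1\<close>, this
      gives \<open>d > 1\<close>, a contradiction; so the two numbers of trailing ones
      agree.\<close>
    have impossible: False
      if "a < b" "b < r" "a = r - 1 \<or> d > 1"
        "rev (us @ d # replicate a 1) = rev (vs @ e # replicate b 1)" for a b d e :: nat and us vs
    proof -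
      have "rev (us @ d # replicate a 1) ! a = d" by (simp add: nth_append)
      moreover have "rev (vs @ e # replicate b 1) ! a = 1" using that(1) by (simp add: nth_append)
      ultimately show False using that by simp
    qed
    have "m = m'"
      using impossible[of m m' c xs xs' c'] impossible[of m' m c' xs' xs c] eq t lt
      by (metis linorder_neqE_nat)
    then have "xs = xs' \<and> c = c'" using eq by simp
    then show "p = q" using \<open>m = m'\<close> t by (auto simp: p q tails_def)
  qed
  have "adm_compositions n = U \<union> g ` D"
  proof (intro equalityI subsetI)
    fix xs assume "xs \<in> adm_compositions n"
    then have xs: "sum_list xs = n" "0 \<notin> set xs" "adm xs" by (auto simp: adm_compositions_def)
    have mem: "xs \<in> g ` D"
      if "xs = ys @ c # replicate m 1" "(c, m) \<in> tails (c + m)" "adm ys" for ys c m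
    proof -
      have "(c + m, (c, m), ys) \<in> D"
        using that xs by (auto simp: D_def adm_compositions_def sum_list_replicate)
      moreover have "g (c + m, (c, m), ys) = xs" using that by (simp add: g_def)
      ultimately show ?thesis by (metis image_eqI)
    qed
    from xs(2) show "xs \<in> U \<union> g ` D"
    proof (cases rule: composition_cases)
      case (1 m)
      then show ?thesis using xs(1) by (simp add: U_def sum_list_replicate)
    next
      case (2 ys c m)
      then have "adm ys \<and> is_bottom r S c" using adm_append_short[of ys c m] xs by auto
      then show ?thesis using mem[OF 2(1)] 2 by (auto simp: tails_def)
    next
      case (3 ys c)
      then have "adm ys \<and> is_top r S c" using adm_append_tuple[of ys c] xs by auto
      then show ?thesis using mem[OF 3(1)] by (auto simp: tails_def)
    qed
  next
    fix xs assume "xs \<in> U \<union> g ` D"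
    then consider "xs \<in> U" | "xs \<in> g ` D" by blast
    then show "xs \<in> adm_compositions n"
    proof cases
      case 1
      then show ?thesis
        using adm_replicate[of n]
        by (auto simp: U_def adm_compositions_def sum_list_replicate split: if_splits)
    next
      case 2
      then obtain k c m ys where k: "k \<le> n" and t: "(c, m) \<in> tails k"
        and ys: "ys \<in> adm_compositions (n - k)" and xs: "xs = ys @ c # replicate m 1"
        by (auto simp: D_def g_def)
      have pos: "c > 0" using t top_or_bottom_pos by (auto simp: tails_def)
      have "adm xs"
        using t ys adm_append_short[of ys c m] adm_append_tuple[of ys c] pos unfolding xs
        by (auto simp: tails_def adm_compositions_def)
      then show ?thesis
        using t ys k pos by (auto simp: xs tails_def adm_compositions_def sum_list_replicate)
    qed
  qed
  moreover have "U \<inter> g ` D = {}"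
  proof -
    \<comment> \<open>In a list of ones the leading part of the tail is 1, which forces
      \<open>m = r - 1\<close> and hence at least \<open>r\<close> parts.\<close>
    have False if n: "n < r" and "(k, (c, m), ys) \<in> D" "replicate n 1 = ys @ c # replicate m 1"
      for k c m ys
    proof -
      have t: "(c, m) \<in> tails k" using that by (simp add: D_def)
      have "c \<in> set (replicate n 1)" unfolding that(3) by simp
      then have "c = 1" by simp
      then have "m = r - 1" using lt[OF t] by simp
      moreover have "n = length (ys @ c # replicate m 1)"
        unfolding that(3)[symmetric] by simp
      ultimately show False using n by simp
    qed
    then show ?thesis by (auto simp: U_def g_def)
  qed
  ultimately have "card (adm_compositions n) = card U + card (g ` D)"
    using finD by (simp add: card_Un_disjoint U_def)
  also have "card (g ` D) = card D" using inj by (rule card_image)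
  also have "card D = (\<Sum>k\<le>n. card (tails k) * card (adm_compositions (n - k)))"
    unfolding D_def
    by (subst card_SigmaI) (auto simp: finite_tails finite_adm_compositions card_cartesian_product)
  finally show ?thesis by (simp add: U_def)
qed

subsection \<open>Generating functions\<close>

definition tops :: "real fps" where
  "tops = Abs_fps (\<lambda>n. if is_top r S n then 1 else 0)"

definition bottoms :: "real fps" where
  "bottoms = Abs_fps (\<lambda>n. if is_bottom r S n then 1 else 0)"

definition sign :: "nat \<Rightarrow> real" where
  "sign n = (if n \<in> S then if [n = 1] (mod r) then 1 else -1 else 0)"

lemma run_weight_eq: "run_weight r S n = card (adm_compositions n)"
  by (simp add: run_weight_eq_card adm_compositions_def)

lemma run_weight_0: "run_weight r S 0 = 1"
proof -
  have "adm_compositions 0 = {[]}"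
    using adm_replicate[of 0] r by (auto simp: adm_compositions_def sum_list_eq_0_iff)
      (metis list.set_sel(1))
  then show ?thesis by (simp add: run_weight_eq)
qed

lemma card_tails:
  "card (tails k) = (\<Sum>m<r - 1. if m \<le> k \<and> k - m > 1 \<and> is_bottom r S (k - m) then 1 else 0) +
     (if r - 1 \<le> k \<and> is_top r S (k - (r - 1)) then 1 else 0)"
proof -
  let ?P = "\<lambda>m. m \<le> k \<and> k - m > 1 \<and> is_bottom r S (k - m)"
  let ?M = "{m \<in> {..<r - 1}. ?P m}"
  let ?N = "if r - 1 \<le> k \<and> is_top r S (k - (r - 1)) then {r - 1} else {}"
  have "tails k = (\<lambda>m. (k - m, m)) ` (?M \<union> ?N)"
    by (auto simp: tails_def image_iff split: if_splits)
  then have "card (tails k) = card (?M \<union> ?N)"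
    by (simp add: card_image inj_on_def)
  also have "\<dots> = card ?M + card ?N"
    by (rule card_Un_disjoint) auto
  also have "card ?M = (\<Sum>m<r - 1. if ?P m then 1 else 0)"
    by (subst card_eq_sum, rule sum.inter_filter) simp
  finally show ?thesis by simp
qed

text \<open>The geometric sum accounts for the trailing ones. Short tails require
  \<open>c > 1\<close>, and 1 is always a bottom, so \<open>fps_X\<close> is subtracted from
  \<open>bottoms\<close>; full tails admit every top.\<close>

lemma tails_fps:
  "Abs_fps (\<lambda>k. real (card (tails k))) =
     (bottoms - fps_X) * (\<Sum>m<r - 1. fps_X ^ m) + tops * fps_X ^ (r - 1)"
proof (rule fps_ext)
  fix k
  have b: "(bottoms - fps_X) $ j = (if j > 1 \<and> is_bottom r S j then 1 else 0)" for j
    using bottom_1 top_or_bottom_pos[of j]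
    by (cases "j = 1") (auto simp: bottoms_def fps_X_nth)
  have "real (card (tails k)) =
      (\<Sum>m<r - 1. if m \<le> k \<and> k - m > 1 \<and> is_bottom r S (k - m) then 1 else 0) +
      (if r - 1 \<le> k \<and> is_top r S (k - (r - 1)) then 1 else 0)"
    unfolding card_tails by (simp add: if_distrib[of real] cong: if_cong)
  also have "(\<Sum>m<r - 1. if m \<le> k \<and> k - m > 1 \<and> is_bottom r S (k - m) then 1 else 0) =
      (\<Sum>m<r - 1. (bottoms - fps_X) * fps_X ^ m) $ k"
    by (auto simp: fps_sum_nth fps_X_power_mult_right_nth b simp del: fps_sub_nth
        intro!: sum.cong)
  also have "(if r - 1 \<le> k \<and> is_top r S (k - (r - 1)) then 1 else 0) = (tops * fps_X ^ (r - 1)) $ k"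
    by (auto simp: fps_X_power_mult_right_nth tops_def)
  finally show "Abs_fps (\<lambda>k. real (card (tails k))) $ k =
      ((bottoms - fps_X) * (\<Sum>m<r - 1. fps_X ^ m) + tops * fps_X ^ (r - 1)) $ k"
    by (simp add: sum_distrib_left)
qed

lemma run_weight_fps:
  "Abs_fps (\<lambda>n. real (run_weight r S n)) = (\<Sum>m<r. fps_X ^ m) +
     Abs_fps (\<lambda>k. real (card (tails k))) * Abs_fps (\<lambda>n. real (run_weight r S n))"
proof (rule fps_ext)
  fix n
  have "(\<Sum>m<r. fps_X ^ m :: real fps) $ n = (if n < r then 1 else 0)"
    by (simp add: fps_sum_nth)
  then show "Abs_fps (\<lambda>n. real (run_weight r S n)) $ n = ((\<Sum>m<r. fps_X ^ m) +
     Abs_fps (\<lambda>k. real (card (tails k))) * Abs_fps (\<lambda>n. real (run_weight r S n))) $ n"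
    using card_adm_compositions[of n]
    by (simp add: fps_mult_nth run_weight_eq atLeast0AtMost)
qed

text \<open>On a maximal interval from \<open>b\<close> to \<open>t\<close> the signed indicator is an alternating sum,
  and multiplication by \<open>1 - x^r\<close> makes it telescope to
  \<open>x^b (1 - x^(r-1)) + x^t (x^(r-1) - x^r)\<close>.\<close>

lemma sign_fps:
  "(1 - fps_X ^ r) * Abs_fps sign =
     bottoms * (1 - fps_X ^ (r - 1)) + tops * (fps_X ^ (r - 1) - fps_X ^ r)"
proof (rule fps_ext)
  fix n
  define bt where "bt j = (if is_bottom r S j then 1 else 0 :: real)" for j
  define tp where "tp j = (if is_top r S j then 1 else 0 :: real)" for j
  have zero: "bt j = 0" "tp j = 0" if "j mod r \<noteq> 1" for j
    using top_or_bottom_cong[of j] that r by (auto simp: bt_def tp_def cong_def)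
  have sign_0: "sign j = 0" if "j mod r \<noteq> 0" "j mod r \<noteq> 1" for j
    using S_subset that by (auto simp: sign_def Nstar_iff)
  have sign_mult: "sign (k * r) = (if k * r \<in> S then -1 else 0)" for k
    using r by (simp add: sign_def cong_def)
  have sign_Suc: "sign (k * r + 1) = (if k * r + 1 \<in> S then 1 else 0)" for k
    using r by (simp add: sign_def cong_def mod_Suc)
  have "((1 - fps_X ^ r) * Abs_fps sign) $ n = sign n - (if n < r then 0 else sign (n - r))"
    by (simp add: left_diff_distrib fps_X_power_mult_nth)
  also have "sign n - (if n < r then 0 else sign (n - r)) =
      bt n - (if n < r - 1 then 0 else bt (n - (r - 1))) +
      ((if n < r - 1 then 0 else tp (n - (r - 1))) - (if n < r then 0 else tp (n - r)))"
  proof -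
    \<comment> \<open>The values 0 and 1 are separated because for them \<open>n - r\<close> is not
      a genuine index; elsewhere the residue of \<open>n\<close> decides which terms
      survive.\<close>
    consider "n = 0" | "n = 1" | k where "n = Suc k * r" | k where "n = Suc k * r + 1"
      | "n mod r \<noteq> 0" "n mod r \<noteq> 1"
    proof -
      have n: "n = (n div r) * r + n mod r" by simp
      show ?thesis
      proof (cases "n div r")
        case 0
        then show ?thesis using that n by (metis add_0 mult_0)
      next
        case (Suc k)
        then show ?thesis using that n by (metis add.right_neutral)
      qed
    qed
    then show ?thesis
    proof cases
      case 1
      then show ?thesis using r zero_notin zero(1)[of 0] by (simp add: sign_def)
    next
      case 2
      then show ?thesis using r one_in bottom_1 by (simp add: sign_def bt_def)
    next
      case (3 k)
      have n: "n - r = k * r" "n - (r - 1) = k * r + 1" and ge: "\<not> n < r" "\<not> n < r - 1"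
        using 3 r by auto
      \<comment> \<open>This merges the two alternatives of \<open>is_bottom_iff\<close>, so that
        bottom 1 needs no case of its own.\<close>
      have "k * r \<notin> S" if "k = 0" using that zero_notin by simp
      then have bt: "bt (n - (r - 1)) = (if k * r + 1 \<in> S \<and> k * r \<notin> S then 1 else 0)"
        unfolding n(2) bt_def is_bottom_iff by auto
      have tp: "tp (n - (r - 1)) = (if k * r + 1 \<in> S \<and> Suc k * r \<notin> S then 1 else 0)"
        unfolding n(2) tp_def is_top_iff by simp
      have z: "bt n = 0" "tp (n - r) = 0" unfolding n(1) using 3 r by (simp_all add: zero)
      have sg: "sign n = (if Suc k * r \<in> S then -1 else 0)"
        "sign (n - r) = (if k * r \<in> S then -1 else 0)"
        unfolding n(1) unfolding 3 by (rule sign_mult)+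
      \<comment> \<open>Here \<open>a\<close>, \<open>b\<close>, \<open>c\<close> stand for
        membership of \<open>Suc k * r\<close>, \<open>k * r + 1\<close>, \<open>k * r\<close> in
        \<open>S\<close>; the two implications are odd-endedness.\<close>
      have "(if a then -1 else 0) - (if c then -1 else 0) =
          0 - (if b \<and> \<not> c then 1 else 0) + ((if b \<and> \<not> a then 1 else 0) - (0::real))"
        if "a \<longrightarrow> b" "c \<longrightarrow> b" for a b c
        using that by (cases a; cases b; cases c; simp)
      moreover have "k * r \<in> S \<longrightarrow> k * r + 1 \<in> S"
        using zero_notin neighbours_in_S(1) by (cases k) auto
      moreover have "Suc k * r \<in> S \<longrightarrow> k * r + 1 \<in> S"
        using neighbours_in_S(2) by blast
      ultimately show ?thesis unfolding bt tp z sg if_not_P[OF ge(1)] if_not_P[OF ge(2)] by blast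
    next
      case (4 k)
      have n: "n - r = k * r + 1" "n - (r - 1) = k * r + 2" and ge: "\<not> n < r" "\<not> n < r - 1"
        using 4 r by auto
      \<comment> \<open>As \<open>r > 2\<close>, the residue 2 differs from 1, so this number is
        neither a top nor a bottom.\<close>
      have "(k * r + 2) mod r = 2" using r by (simp only: mod_mult_self3 mod_less)
      then have z: "bt (n - (r - 1)) = 0" "tp (n - (r - 1)) = 0"
        unfolding n(2) by (simp_all add: zero)
      have bt: "bt n = (if Suc k * r + 1 \<in> S \<and> Suc k * r \<notin> S then 1 else 0)"
        unfolding 4 bt_def is_bottom_iff by simp
      have tp: "tp (n - r) = (if k * r + 1 \<in> S \<and> Suc k * r \<notin> S then 1 else 0)"
        unfolding n(1) tp_def is_top_iff by simp
      have sg: "sign n = (if Suc k * r + 1 \<in> S then 1 else 0)"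
        "sign (n - r) = (if k * r + 1 \<in> S then 1 else 0)"
        unfolding n(1) unfolding 4 by (rule sign_Suc)+
      \<comment> \<open>Now \<open>a\<close>, \<open>b\<close>, \<open>c\<close> stand for
        membership of \<open>Suc k * r\<close>, \<open>Suc k * r + 1\<close>,
        \<open>k * r + 1\<close> in \<open>S\<close>.\<close>
      have "(if b then 1 else 0) - (if c then 1 else 0) =
          (if b \<and> \<not> a then 1 else 0) - 0 + (0 - (if c \<and> \<not> a then 1 else (0::real)))"
        if "a \<longrightarrow> b \<and> c" for a b c
        using that by (cases a; cases b; cases c; simp)
      moreover have "Suc k * r \<in> S \<longrightarrow> Suc k * r + 1 \<in> S \<and> k * r + 1 \<in> S"
        using neighbours_in_S by blast
      ultimately show ?thesis unfolding bt tp z sg if_not_P[OF ge(1)] if_not_P[OF ge(2)] by blast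
    next
      case 5
      have shift: "(n - r) mod r = n mod r" if "\<not> n < r"
        using that by (simp add: le_mod_geq)
      \<comment> \<open>Residue 1 here would make \<open>n\<close> a multiple of
        \<open>r\<close>.\<close>
      have "(n - (r - 1)) mod r \<noteq> 1" if "\<not> n < r - 1"
      proof
        assume "(n - (r - 1)) mod r = 1"
        then have "(n - (r - 1) + (r - 1)) mod r = (1 + (r - 1)) mod r"
          by (metis mod_add_left_eq)
        then show False using that 5(1) r by simp
      qed
      then show ?thesis
        using 5 shift by (auto simp: sign_0 zero)
    qed
  qed
  also have "\<dots> = (Abs_fps bt * (1 - fps_X ^ (r - 1)) +
      Abs_fps tp * (fps_X ^ (r - 1) - fps_X ^ r)) $ n"
    by (simp add: right_diff_distrib fps_X_power_mult_right_nth)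
  also have "Abs_fps bt = bottoms" by (simp add: bottoms_def bt_def[abs_def])
  also have "Abs_fps tp = tops" by (simp add: tops_def tp_def[abs_def])
  finally show "((1 - fps_X ^ r) * Abs_fps sign) $ n =
      (bottoms * (1 - fps_X ^ (r - 1)) + tops * (fps_X ^ (r - 1) - fps_X ^ r)) $ n" .
qed

text \<open>Multiplication by \<open>1 - x\<close> collapses the geometric sums, and
  \<open>sign_fps\<close> turns the tail series into
  \<open>(1 - x) (1 - K) = (1 - x^r) (1 - F)\<close>. The equation for the run weights then yields
  the claim after cancelling \<open>1 - x^r\<close>.\<close>

theorem run_weight_fps_inverse: "Abs_fps (\<lambda>n. real (run_weight r S n)) * (1 - Abs_fps sign) = 1"
proof -
  let ?W = "Abs_fps (\<lambda>n. real (run_weight r S n))" and ?F = "Abs_fps sign"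
  let ?X = "fps_X :: real fps" and ?K = "Abs_fps (\<lambda>k. real (card (tails k)))"
  let ?Q = "\<Sum>m<r - 1. ?X ^ m"
  have Q: "(1 - ?X) * ?Q = 1 - ?X ^ (r - 1)" by (rule one_diff_power_eq[symmetric])
  have Xr: "?X ^ r = ?X * ?X ^ (r - 1)" using r by (simp flip: power_Suc)
  have "(1 - ?X) * ?K = (bottoms - ?X) * ((1 - ?X) * ?Q) + tops * (?X ^ (r - 1) - ?X ^ r)"
    unfolding tails_fps Xr by (simp add: algebra_simps)
  also have "\<dots> = (1 - ?X ^ r) * ?F - ?X * (1 - ?X ^ (r - 1))"
    unfolding Q sign_fps by (simp add: algebra_simps)
  finally have K: "(1 - ?X) * (1 - ?K) = (1 - ?X ^ r) * (1 - ?F)"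
    unfolding Xr by (simp add: algebra_simps)
  have "(?W * (1 - ?F)) * (1 - ?X ^ r) = ?W * ((1 - ?X ^ r) * (1 - ?F))"
    by (simp only: ac_simps)
  also have "\<dots> = (1 - ?X) * (?W - ?K * ?W)"
    unfolding K[symmetric] by (simp add: algebra_simps)
  also have "?W - ?K * ?W = (\<Sum>m<r. ?X ^ m)"
    using run_weight_fps by (simp add: diff_eq_eq)
  also have "(1 - ?X) * (\<Sum>m<r. ?X ^ m) = 1 * (1 - ?X ^ r)"
    by (simp add: one_diff_power_eq)
  finally have "(?W * (1 - ?F)) * (1 - ?X ^ r) = 1 * (1 - ?X ^ r)" .
  moreover have "1 - ?X ^ r \<noteq> 0"
  proof
    assume "1 - ?X ^ r = 0"
    then have "(1 - ?X ^ r) $ 0 = 0" by simp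
    then show False using r by simp
  qed
  ultimately show ?thesis by (metis mult_right_cancel)
qed

lemma run_weight_rec:
  assumes "n > 0"
  shows "real (run_weight r S n) = (\<Sum>k\<in>{1..n}. sign k * real (run_weight r S (n - k)))"
proof -
  let ?w = "\<lambda>n. real (run_weight r S n)"
  have "Abs_fps ?w = 1 + Abs_fps sign * Abs_fps ?w"
    using run_weight_fps_inverse by (simp add: algebra_simps)
  then have "Abs_fps ?w $ n = (1 + Abs_fps sign * Abs_fps ?w) $ n" by simp
  then have "?w n = (\<Sum>k\<in>{0..n}. sign k * ?w (n - k))"
    using assms by (simp add: fps_mult_nth)
  also have "\<dots> = (\<Sum>k\<in>{1..n}. sign k * ?w (n - k))"
    using zero_notin by (simp add: sum.atLeast_Suc_atMost sign_def)
  finally show ?thesis .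
qed

text \<open>The coefficients of the exponential equation give a binomial recursion for
  \<open>c\<close> with the same numbers \<open>sign k\<close> as in \<open>run_weight_rec\<close>;
  this pair of recursions is what \<open>sum_string_weight_eq\<close> requires.\<close>

theorem sum_perm_weight:
  fixes c :: "nat \<Rightarrow> real"
  assumes "(1 - Abs_fps (\<lambda>n. sign n / fact n)) * Abs_fps (\<lambda>n. c n / fact n) = 1"
  shows "(\<Sum>\<sigma>\<in>permutations_of_set {1..n}. real (perm_weight r S \<sigma>)) = c n"
proof -
  let ?w = "\<lambda>n. real (run_weight r S n)"
  have sign_0: "sign 0 = 0" using zero_notin by (simp add: sign_def)
  have coeff: "c n / fact n = (if n = 0 then 1 else 0) +
      (\<Sum>k\<le>n. sign k / fact k * (c (n - k) / fact (n - k)))" for n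
  proof -
    have "Abs_fps (\<lambda>n. c n / fact n) =
        1 + Abs_fps (\<lambda>n. sign n / fact n) * Abs_fps (\<lambda>n. c n / fact n)"
      using assms by (simp add: algebra_simps)
    then have "Abs_fps (\<lambda>n. c n / fact n) $ n =
        (1 + Abs_fps (\<lambda>n. sign n / fact n) * Abs_fps (\<lambda>n. c n / fact n)) $ n" by simp
    then show ?thesis by (simp add: fps_mult_nth atLeast0AtMost)
  qed
  have "c 0 = 1" using coeff[of 0] sign_0 by simp
  have c_rec: "c m = (\<Sum>k\<le>m. of_nat (m choose k) * (sign k * c (m - k)))" if "m > 0" for m
  proof -
    have "c m = fact m * (c m / fact m)" by simp
    also have "\<dots> = (\<Sum>k\<le>m. fact m * (sign k / fact k * (c (m - k) / fact (m - k))))"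
      using that by (subst coeff) (simp add: sum_distrib_left)
    also have "\<dots> = (\<Sum>k\<le>m. of_nat (m choose k) * (sign k * c (m - k)))"
      by (intro sum.cong refl) (simp add: binomial_fact)
    finally show ?thesis .
  qed
  have "real (perm_weight r S \<sigma>) = string_weight ?w \<sigma>" for \<sigma>
    by (simp add: perm_weight_def string_weight_def case_prod_unfold)
  then have "(\<Sum>\<sigma>\<in>permutations_of_set {1..n}. real (perm_weight r S \<sigma>)) =
      (\<Sum>\<sigma>\<in>permutations_of_set {1..n}. string_weight ?w \<sigma>)" by simp
  also have "\<dots> = c (card {1..n})"
  proof (rule sum_string_weight_eq)
    show "?w 0 = 1" by (simp add: run_weight_0)
  qed (fact run_weight_rec sign_0 \<open>c 0 = 1\<close> c_rec finite_atLeastAtMost)+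
  finally show ?thesis by simp
qed

end

section \<open>Passage to the exponential generating functions of \<open>A\<close> and
  \<open>B\<close>\<close>

theorem corollary4p8:
  fixes r :: nat and A B :: "nat set" and c :: "nat \<Rightarrow> real"
  assumes "r > 2"
    and "A \<subseteq> {x. x \<ge> 1 \<and> [x = 1] (mod r)}"
    and "B \<subseteq> {x. x \<ge> 1 \<and> [x = 0] (mod r)}"
    and "1 \<in> A"
    and "odd_ended r (A \<union> B)"
    and "inverse (1 - egf_of_set A + egf_of_set B) = Abs_fps (\<lambda>n. c n / fact n)"
  shows "\<forall>n. c n \<in> \<nat> \<and>
    c n = (\<Sum>\<sigma>\<in>permutations_of_set {1..n}. real (perm_weight r (A \<union> B) \<sigma>))"
proof -
  interpret odd_ended_set r "A \<union> B"
    using assms(1-5) by unfold_locales (auto simp: Nstar_def)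
  have B_not_1: "\<not> [x = 1] (mod r)" if "x \<in> B" for x
    using that assms(1,3) by (auto simp: cong_def)
  \<comment> \<open>The residues 1 and 0 differ, so \<open>A\<close> and \<open>B\<close> are
    disjoint and \<open>sign\<close> separates them.\<close>
  have "1 - egf_of_set A + egf_of_set B = 1 - Abs_fps (\<lambda>n. sign n / fact n)"
  proof (rule fps_ext)
    fix n
    show "(1 - egf_of_set A + egf_of_set B) $ n = (1 - Abs_fps (\<lambda>n. sign n / fact n)) $ n"
      using assms(2) B_not_1[of n] by (auto simp: egf_of_set_def sign_def)
  qed
  \<comment> \<open>A nonzero constant coefficient ensures that \<open>inverse\<close> is a true
    multiplicative inverse.\<close>
  moreover have "(1 - Abs_fps (\<lambda>n. sign n / fact n)) $ 0 \<noteq> 0"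
    using zero_notin by (simp add: sign_def)
  ultimately have "(1 - Abs_fps (\<lambda>n. sign n / fact n)) * Abs_fps (\<lambda>n. c n / fact n) = 1"
    using assms(6) inverse_mult_eq_1' by metis
  then have "c n = (\<Sum>\<sigma>\<in>permutations_of_set {1..n}. real (perm_weight r (A \<union> B) \<sigma>))" for n
    by (rule sum_perm_weight[symmetric])
  \<comment> \<open>Integrality and non-negativity are read off from the sum, whose terms are
    natural numbers.\<close>
  moreover from this have "c n \<in> \<nat>" for n
    by (metis of_nat_in_Nats of_nat_sum)
  ultimately show ?thesis by blast
qed

end
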